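(* Let $a\in\mathbb{R}^{d\times(n+1)}$ with $f_i^L=a_{i0}<\cdots<a_{in}=f_i^U$ for each $i$, let $0=\tau(i,0)<\cdots<\tau(i,l_i)=n$ be integers for each $i\in\{1,\dots,d\}$, and let $\mathcal{H}=\{\prod_{i=1}^d[a_{i\tau(i,t_i-1)},a_{i\tau(i,t_i)}]\mid t\in\prod_{i=1}^d\{1,\dots,l_i\}\}$. Let $\phi:\mathbb{R}^d\to\mathbb{R}$. Then $$\Bigl\{(f,\mu,z,\delta)\Bigm|\mu\le\mathrm{conc}_\Delta(\phi\circ F)(z),\ f=F(z),\ z\in\Delta,\ \delta_{it}\in\{0,1\},\ z_{i\tau(i,t)}\ge\delta_{it}\ge z_{i\tau(i,t)+1}\ (1\le i\le d,\ 1\le t\le l_i-1)\Bigr\}$$ is an MIP formulation of $\bigcup_{H\in\mathcal{H}}\mathrm{conv}\bigl(\mathrm{hyp}(\phi|_H)\bigr)$ (in the variables $(f,\mu)$). Moreover, if $\phi\circ F:\Delta\to\mathbb{R}$ is concave-extendable from $\mathrm{vert}(\Delta)$, then this is an ideal MILP formulation.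
   Context: $\Delta=\prod_{i=1}^d\Delta_i$ with $\Delta_i=\{z_i\in\mathbb{R}^{n+1}\mid1=z_{i0}\ge z_{i1}\ge\cdots\ge z_{in}\ge0\}$. $F(z)=(F_1(z_1),\dots,F_d(z_d))$ with $F_i(z_i)=a_{i0}z_{i0}+\sum_{j=1}^n(a_{ij}-a_{i,j-1})z_{ij}$, and $(\phi\circ F)(z)=\phi(F(z))$. $\mathrm{hyp}(\phi|_H)=\{(f,\mu)\mid\mu\le\phi(f),\ f\in H\}$, and $\mathrm{conv}$ denotes the convex hull. $\mathrm{conc}_\Delta(g)$ is the concave envelope of $g$ over $\Delta$, i.e. the smallest concave function on $\Delta$ that overestimates $g$. A function $g$ on a polytope $S$ is concave-extendable from $Y\subseteq S$ if the concave envelope over $S$ of $g$ equals that of the restriction of $g$ to $Y$ (set to $-\infty$ off $Y$). For a set $S\subseteq\mathbb{R}^{n_1}$, a set $E=R\cap(\mathbb{R}^{n_1}\times\mathbb{R}^{n_2}\times\{0,1\}^{n_3})$ with $R$ in the space of variables $(x,y,\delta)$ is an MIP formulation of $S$ if $S=\mathrm{proj}_x(E)$; $R$ is its continuous relaxation (here obtained by replacing $\delta_{it}\in\{0,1\}$ by $\delta_{it}\in[0,1]$). It is an MILP formulation if $R$ is a polyhedron, and it is ideal if $\mathrm{proj}_\delta(\mathrm{vert}(R))\subseteq\{0,1\}^{n_3}$, where $\mathrm{vert}$ denotes the set of extreme points.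
   Formalization: The first claim (MIP formulation) is proved for φ upper semicontinuous on the box ∏[f_i^L, f_i^U], since it fails for arbitrary φ; the "moreover" claim, including being an MIP formulation, is proved for arbitrary φ. *)

theory Defs
  imports "HOL-Analysis.Analysis"
begin

section \<open>Concave envelopes\<close>

text \<open>
  Functions are extended-real-valued, because restricting a function to a subset sets it to
  \<open>-\<infinity>\<close> elsewhere, and because the envelope of a function without a concave majorant
  is \<open>\<infinity>\<close>. Concavity means convexity of the hypograph (over real heights), which avoids
  giving a meaning to \<open>\<infinity> - \<infinity>\<close>.
\<close>

definition ereal_concave_on :: "'a::real_vector set \<Rightarrow> ('a \<Rightarrow> ereal) \<Rightarrow> bool" where
  "ereal_concave_on S h \<longleftrightarrow> convex {(x, \<mu>::real). x \<in> S \<and> ereal \<mu> \<le> h x}"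

definition conc :: "'a::real_vector set \<Rightarrow> ('a \<Rightarrow> ereal) \<Rightarrow> 'a \<Rightarrow> ereal" where
  "conc S g x = (INF h \<in> {h. ereal_concave_on S h \<and> (\<forall>y\<in>S. g y \<le> h y)}. h x)"

lemma conc_concave: "ereal_concave_on S (conc S g)" if "convex S"
proof -
  let ?M = "{h. ereal_concave_on S h \<and> (\<forall>y\<in>S. g y \<le> h y)}"
  have "{(x, \<mu>::real). x \<in> S \<and> ereal \<mu> \<le> \<infinity>} = S \<times> UNIV" by auto
  then have top: "(\<lambda>_. \<infinity>) \<in> ?M"
    using that by (simp add: ereal_concave_on_def convex_Times)
  then have "{(x, \<mu>::real). x \<in> S \<and> ereal \<mu> \<le> conc S g x}
      = (\<Inter>h\<in>?M. {(x, \<mu>::real). x \<in> S \<and> ereal \<mu> \<le> h x})"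
    unfolding conc_def le_INF_iff by blast
  then show ?thesis
    unfolding ereal_concave_on_def by (auto intro!: convex_INT)
qed

lemma conc_overestimates: "x \<in> S \<Longrightarrow> g x \<le> conc S g x"
  unfolding conc_def by (rule INF_greatest) auto

lemma conc_least:
  "ereal_concave_on S h \<Longrightarrow> (\<And>y. y \<in> S \<Longrightarrow> g y \<le> h y) \<Longrightarrow> conc S g x \<le> h x"
  unfolding conc_def by (rule INF_lower) auto

definition concave_extendable :: "'a::real_vector set \<Rightarrow> 'a set \<Rightarrow> ('a \<Rightarrow> ereal) \<Rightarrow> bool" where
  "concave_extendable S Y g \<longleftrightarrow>
     (\<forall>x\<in>S. conc S g x = conc S (\<lambda>y. if y \<in> Y then g y else -\<infinity>) x)"

text \<open>
  Some condition of this kind is needed to pass from \<open>hyp (conc g)\<close> to the convex hull of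
  \<open>hyp g\<close>: if \<open>g (1/2) = 0\<close> and \<open>g x = 1 - \<bar>x - 1/2\<bar>\<close> elsewhere on \<open>[0, 1]\<close>, then
  the envelope is \<open>1\<close> at \<open>1/2\<close>, but \<open>g < 1\<close>, so \<open>(1/2, 1)\<close> is not in the hull.
\<close>

definition usc_on :: "'a::topological_space set \<Rightarrow> ('a \<Rightarrow> real) \<Rightarrow> bool" where
  "usc_on S g \<longleftrightarrow> (\<forall>c. closedin (top_of_set S) {x \<in> S. c \<le> g x})"

definition hyp :: "'a set \<Rightarrow> ('a \<Rightarrow> real) \<Rightarrow> ('a \<times> real) set" where
  "hyp H g = {(f, \<mu>). \<mu> \<le> g f \<and> f \<in> H}"

definition vert :: "'a::real_vector set \<Rightarrow> 'a set" where
  "vert S = {v. v extreme_point_of S}"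

section \<open>Mixed-integer formulations\<close>

definition binary :: "(real ^ 'm) set" where
  "binary = {\<delta>. \<forall>k. \<delta> $ k \<in> {0, 1}}"

definition mip_formulation ::
    "'x set \<Rightarrow> ('x \<times> 'y \<times> (real ^ 'm)) set \<Rightarrow> ('x \<times> 'y \<times> (real ^ 'm)) set \<Rightarrow> bool" where
  "mip_formulation S E R \<longleftrightarrow> E = R \<inter> (UNIV \<times> UNIV \<times> binary) \<and> S = fst ` E"

definition milp_formulation ::
    "'x::euclidean_space set \<Rightarrow> ('x \<times> 'y::euclidean_space \<times> (real ^ 'm)) set
      \<Rightarrow> ('x \<times> 'y \<times> (real ^ 'm)) set \<Rightarrow> bool" where
  "milp_formulation S E R \<longleftrightarrow> mip_formulation S E R \<and> polyhedron R"

definition ideal :: "('x::real_vector \<times> 'y::real_vector \<times> (real ^ 'm)) set \<Rightarrow> bool" where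
  "ideal R \<longleftrightarrow> (\<lambda>(x, y, \<delta>). \<delta>) ` vert R \<subseteq> binary"

section \<open>The incremental model\<close>

text \<open>
  The coordinates \<open>i = 1, \<dots>, d\<close> are the elements of \<open>'d\<close>. The \<open>n + 1\<close> indices
  \<open>j = 0, \<dots>, n\<close> are the elements of \<open>'k\<close> in increasing order, where \<open>CARD('k) = n + 1\<close>;
  \<open>idx j\<close> is the element number \<open>j\<close>, to be used for \<open>j \<le> n\<close> only.
\<close>

definition idx :: "nat \<Rightarrow> 'k::{finite, linorder}" where
  "idx j = sorted_list_of_set UNIV ! j"

definition Delta :: "nat \<Rightarrow> (real ^ 'k::{finite, linorder} ^ 'd) set" where
  "Delta n = {z. \<forall>i. z $ i $ idx 0 = 1 \<and> (\<forall>j<n. z $ i $ idx (Suc j) \<le> z $ i $ idx j)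
                  \<and> 0 \<le> z $ i $ idx n}"

definition F ::
    "nat \<Rightarrow> ('d \<Rightarrow> nat \<Rightarrow> real) \<Rightarrow> real ^ 'k::{finite, linorder} ^ 'd \<Rightarrow> real ^ 'd" where
  "F n a z = (\<chi> i. a i 0 * z $ i $ idx 0 + (\<Sum>j=1..n. (a i j - a i (j - 1)) * z $ i $ idx j))"

definition boxes ::
    "('d \<Rightarrow> nat \<Rightarrow> real) \<Rightarrow> ('d \<Rightarrow> nat \<Rightarrow> nat) \<Rightarrow> ('d \<Rightarrow> nat) \<Rightarrow> (real ^ 'd) set set" where
  "boxes a \<tau> l = {cbox (\<chi> i. a i (\<tau> i (t i - 1))) (\<chi> i. a i (\<tau> i (t i))) | t. \<forall>i. t i \<in> {1..l i}}"

text \<open>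
  The variables \<open>\<delta>\<^sub>i\<^sub>t\<close>, \<open>1 \<le> t \<le> l\<^sub>i - 1\<close>, form a ragged and possibly empty family,
  so they are placed in \<open>real ^ ('d \<times> 'k)\<close> (note that \<open>l\<^sub>i - 1 < n\<close>) with \<open>\<delta>\<^sub>i\<^sub>t\<close> at
  position \<open>(i, idx t)\<close>; the unused coordinates are fixed to \<open>0\<close>.
  The parameter \<open>D\<close> is the domain of each \<open>\<delta>\<^sub>i\<^sub>t\<close>: \<open>{0, 1}\<close> in the formulation and
  \<open>[0, 1]\<close> in its continuous relaxation.
\<close>

definition formulation ::
    "real set \<Rightarrow> nat \<Rightarrow> ('d \<Rightarrow> nat \<Rightarrow> real) \<Rightarrow> ('d \<Rightarrow> nat \<Rightarrow> nat) \<Rightarrow> ('d \<Rightarrow> nat) \<Rightarrow> (real ^ 'd \<Rightarrow> real)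
      \<Rightarrow> (((real ^ 'd) \<times> real) \<times> (real ^ 'k::{finite, linorder} ^ 'd) \<times> (real ^ ('d \<times> 'k))) set" where
  "formulation D n a \<tau> l \<phi> =
     {((f, \<mu>), z, \<delta>).
        ereal \<mu> \<le> conc (Delta n) (\<lambda>z. ereal (\<phi> (F n a z))) z \<and> f = F n a z \<and> z \<in> Delta n \<and>
        (\<forall>i. \<forall>t\<in>{1..<l i}. \<delta> $ (i, idx t) \<in> D \<and>
              z $ i $ idx (\<tau> i t) \<ge> \<delta> $ (i, idx t) \<and>
              \<delta> $ (i, idx t) \<ge> z $ i $ idx (\<tau> i t + 1)) \<and>
        (\<forall>i k. k \<notin> idx ` {1..<l i} \<longrightarrow> \<delta> $ (i, k) = 0)}"

end

theory Submission
  imports Defs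
begin

text \<open>
  A binary \<open>\<delta>\<close> confines \<open>z\<close> to a face of \<open>\<Delta>\<close> that \<open>F\<close> maps onto one box \<open>H\<close>. On a face, the concave
  envelope over \<open>\<Delta>\<close> only depends on the values on that face, so there its hypograph is mapped into
  the closure of the hull of \<open>hyp (\<phi>|H)\<close>. By upper semicontinuity this hull is closed; in the
  extendable case the vertices of the face suffice and already generate a closed hull. Moreover, in
  that case the hypograph of the envelope over \<open>\<Delta>\<close> is generated by the points over the vertices of
  \<open>\<Delta>\<close> and the downward direction, so it is a polyhedron; its decompositions lift to \<open>R\<close>, whose
  extreme points thus lie over vertices of \<open>\<Delta>\<close>.
\<close>

section \<open>Convex hulls of hypographs\<close>

text \<open>The homogenization of \<open>C\<close>: its slice at \<open>s = 1\<close> is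
  \<open>C\<close>, and at \<open>s = 0\<close> only the downward ray remains. Adding a point of
  that ray lowers heights, which is where \<open>down\<close> enters. It transfers statements about
  hulls to cones.\<close>

lemma convex_cone_perspective:
  fixes C :: "('a::real_vector \<times> real) set"
  assumes C: "convex C" and down: "\<And>x \<mu> \<nu>. (x, \<mu>) \<in> C \<Longrightarrow> \<nu> \<le> \<mu> \<Longrightarrow> (x, \<nu>) \<in> C"
  shows "convex_cone {(s, y, w). 0 \<le> s \<and> (s = 0 \<longrightarrow> y = 0 \<and> w \<le> 0)
    \<and> (0 < s \<longrightarrow> (y /\<^sub>R s, w / s) \<in> C)}" (is "convex_cone ?K")
  unfolding convex_cone_iff
proof (intro conjI ballI allI impI)
  show "0 \<in> ?K" by (simp add: zero_prod_def)
next
  have main: "(s1 + s2, y1 + y2, w1 + w2) \<in> ?K"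
    if "(s1, y1, w1) \<in> ?K" "(s2, y2, w2) \<in> ?K" "s2 = 0" for s1 s2 y1 y2 w1 w2
  proof -
    have "(w1 + w2) / s1 \<le> w1 / s1" if "0 < s1"
      using that \<open>(s2, y2, w2) \<in> ?K\<close> \<open>s2 = 0\<close> by (auto intro: divide_right_mono)
    then show ?thesis using that down by fastforce
  qed
  fix p q assume p: "p \<in> ?K" and q: "q \<in> ?K"
  obtain s1 y1 w1 s2 y2 w2 where pq: "p = (s1, y1, w1)" "q = (s2, y2, w2)"
    by (metis prod_cases3)
  consider "s2 = 0" | "s1 = 0" | "s1 > 0" "s2 > 0" using p q pq by fastforce
  then show "p + q \<in> ?K"
  proof cases
    case 1 then show ?thesis using main[OF p[unfolded pq] q[unfolded pq]] pq by simp
  next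
    case 2 then show ?thesis
      using main[OF q[unfolded pq] p[unfolded pq]] pq by (simp only: add_Pair add.commute)
  next
    case 3
    \<comment> \<open>After rescaling to \<open>s = 1\<close>, the sum is a convex combination with
      weights proportional to \<open>s1\<close> and \<open>s2\<close>.\<close>
    have "(s1 / (s1 + s2)) *\<^sub>R (y1 /\<^sub>R s1, w1 / s1) + (s2 / (s1 + s2)) *\<^sub>R (y2 /\<^sub>R s2, w2 / s2) \<in> C"
      using p q pq 3 by (intro convexD[OF C]) (auto simp: add_divide_distrib[symmetric])
    also have "(s1 / (s1 + s2)) *\<^sub>R (y1 /\<^sub>R s1, w1 / s1) + (s2 / (s1 + s2)) *\<^sub>R (y2 /\<^sub>R s2, w2 / s2)
        = ((y1 + y2) /\<^sub>R (s1 + s2), (w1 + w2) / (s1 + s2))"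
    proof -
      have "s1 / (s1 + s2) * inverse s1 = inverse (s1 + s2)" "s2 / (s1 + s2) * inverse s2 = inverse (s1 + s2)"
        "s1 / (s1 + s2) * (w1 / s1) + s2 / (s1 + s2) * (w2 / s2) = (w1 + w2) / (s1 + s2)"
        using 3 by (simp_all add: divide_inverse[symmetric] inverse_eq_divide add_divide_distrib[symmetric])
      then show ?thesis by (simp add: scaleR_add_right)
    qed
    finally show ?thesis using 3 pq by simp
  qed
next
  fix p and c :: real assume p: "p \<in> ?K" and c: "0 \<le> c"
  then show "c *\<^sub>R p \<in> ?K"
  proof (cases "c = 0")
    case False
    obtain s y w where sw: "p = (s, y, w)" by (metis prod_cases3)
    have c0: "c > 0" using False c by simp
    then have eqs: "(c *\<^sub>R y) /\<^sub>R (c * s) = y /\<^sub>R s" "c * w / (c * s) = w / s" "c * s = 0 \<longleftrightarrow> s = 0"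
      "0 < c * s \<longleftrightarrow> 0 < s" "0 \<le> c * s \<longleftrightarrow> 0 \<le> s" "c *\<^sub>R y = 0 \<longleftrightarrow> y = 0" "c * w \<le> 0 \<longleftrightarrow> w \<le> 0"
      by (simp_all add: zero_less_mult_iff zero_le_mult_iff mult_le_0_iff)
    have "c *\<^sub>R p = (c * s, c *\<^sub>R y, c * w)" by (simp add: sw)
    then show ?thesis
      using p unfolding sw by (simp only: mem_Collect_eq prod.case eqs) blast
  next
    case True
    then have "c *\<^sub>R p = (0, 0, 0)" by (simp add: zero_prod_def)
    then show ?thesis by simp
  qed
qed

text \<open>Shifting by a nonpositive vertical vector maps the hypograph into itself, and
  translation commutes with taking the hull.\<close>

lemma convex_hull_hyp_downward:
  assumes "(x, \<mu>) \<in> convex hull (hyp X g)" "\<nu> \<le> \<mu>"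
  shows "(x, \<nu>) \<in> convex hull (hyp X g)"
proof -
  have "(+) (0, \<nu> - \<mu>) ` hyp X g \<subseteq> hyp X g"
    using assms(2) by (auto simp: hyp_def)
  then have "convex hull ((+) (0, \<nu> - \<mu>) ` hyp X g) \<subseteq> convex hull (hyp X g)"
    by (rule hull_mono)
  moreover have "(+) (0, \<nu> - \<mu>) (x, \<mu>) \<in> (+) (0, \<nu> - \<mu>) ` (convex hull (hyp X g))"
    using assms(1) by blast
  ultimately show ?thesis by (simp add: convex_hull_translation subset_iff)
qed

text \<open>If \<open>g\<close> were unbounded, the closed superlevel sets at natural levels would
  have nonempty finite intersections, so compactness would give a point in all of them.\<close>

lemma usc_compact_bounded_above:
  fixes X :: "'a::heine_borel set" and g :: "'a \<Rightarrow> real"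
  assumes X: "compact X" and usc: "\<And>c. closed {x \<in> X. c \<le> g x}"
  shows "\<exists>M. \<forall>x\<in>X. g x \<le> M"
proof (rule ccontr)
  assume neg: "\<not> (\<exists>M. \<forall>x\<in>X. g x \<le> M)"
  have "X \<inter> \<Inter> (range (\<lambda>k. {x \<in> X. real k \<le> g x})) \<noteq> {}"
  proof (rule compact_imp_fip[OF X])
    show "closed T" if "T \<in> range (\<lambda>k. {x \<in> X. real k \<le> g x})" for T
      using that usc by auto
    fix F' assume F': "finite F'" "F' \<subseteq> range (\<lambda>k. {x \<in> X. real k \<le> g x})"
    then obtain N where N: "finite N" "F' = (\<lambda>k. {x \<in> X. real k \<le> g x}) ` N"
      by (meson finite_subset_image)
    obtain m where m: "\<And>k. k \<in> N \<Longrightarrow> k \<le> m" using N(1) Max_ge by blast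
    obtain x where "x \<in> X" "g x > real m" using neg by (meson not_le)
    then have "x \<in> X \<inter> \<Inter> F'" using m unfolding N(2) by fastforce
    then show "X \<inter> \<Inter> F' \<noteq> {}" by blast
  qed
  then obtain x where "\<And>k. real k \<le> g x" by auto
  then show False by (meson not_le reals_Archimedean2)
qed

text \<open>
  With \<open>g \<le> M\<close>, the map \<open>(x, \<mu>) \<mapsto> (s, s x)\<close>, \<open>s = 1 / (1 + M - \<mu>)\<close>, is projective, so it commutes
  with convex hulls, and it sends the hypograph to a bounded set that becomes compact once the
  image \<open>(0, 0)\<close> of \<open>\<mu> = -\<infinity>\<close> is added.
\<close>

lemma closed_convex_hull_hyp:
  fixes X :: "'a::euclidean_space set" and g :: "'a \<Rightarrow> real"
  assumes X: "compact X" and usc: "\<And>c. closed {x \<in> X. c \<le> g x}"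
  shows "closed (convex hull (hyp X g))"
proof -
  obtain M where M: "\<And>x. x \<in> X \<Longrightarrow> g x \<le> M"
    using usc_compact_bounded_above[OF X usc] by blast
  define C where "C = convex hull (hyp X g)"
  \<comment> \<open>The condition is \<open>\<mu> \<le> g x\<close> rewritten for
    \<open>s = 1 / (1 + M - \<mu>)\<close>. At \<open>s = 0\<close> it holds for every
    \<open>x\<close>, which adds the missing limit points.\<close>
  define Q where "Q = {(s, x). x \<in> X \<and> 0 \<le> s \<and> s * (1 + M - g x) \<le> 1}"
  define P where "P = (\<lambda>(s, x). (s, s *\<^sub>R x)) ` Q"
  have s1: "s \<le> 1" if "x \<in> X" "0 \<le> s" "s * (1 + M - g x) \<le> 1" for s x
    using that M[of x] mult_left_mono[of 1 "1 + M - g x" s] by simp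
  have "closed Q"
    unfolding closed_sequential_limits
  proof (intro allI impI, elim conjE)
    fix q l assume q: "\<forall>k. q k \<in> Q" and lim: "q \<longlonglongrightarrow> l"
    obtain s x where l: "l = (s, x)" by fastforce
    have sl: "(\<lambda>k. fst (q k)) \<longlonglongrightarrow> s" and xl: "(\<lambda>k. snd (q k)) \<longlonglongrightarrow> x"
      using tendsto_fst[OF lim] tendsto_snd[OF lim] l by auto
    have qX: "snd (q k) \<in> X" "0 \<le> fst (q k)" "fst (q k) * (1 + M - g (snd (q k))) \<le> 1" for k
      using q[rule_format, of k] by (auto simp: Q_def case_prod_unfold)
    have xX: "x \<in> X"
      using closed_sequentially[OF compact_imp_closed[OF X] _ xl] qX by blast
    have s0: "0 \<le> s" using LIMSEQ_le_const[OF sl] qX by blast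
    have "s * (1 + M - g x) \<le> 1"
    proof (cases "s = 0")
      case False
      then have sp: "s > 0" using s0 by simp
      \<comment> \<open>Every level \<open>c\<close> strictly below the left side is eventually
        below \<open>g\<close> along the sequence, so closedness of the superlevel set passes it to
        the limit \<open>x\<close>.\<close>
      have "1 + M - 1 / s \<le> g x"
      proof (rule dense_le)
        fix c assume c: "c < 1 + M - 1 / s"
        have "(\<lambda>k. 1 + M - 1 / fst (q k)) \<longlonglongrightarrow> 1 + M - 1 / s"
          using sp by (intro tendsto_intros sl) auto
        then have "\<forall>\<^sub>F k in sequentially. c < 1 + M - 1 / fst (q k)"
          using c order_tendstoD(1) by blast
        moreover have "\<forall>\<^sub>F k in sequentially. 0 < fst (q k)"
          using sl sp order_tendstoD(1) by blast
        ultimately have "\<forall>\<^sub>F k in sequentially. snd (q k) \<in> {x \<in> X. c \<le> g x}"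
        proof eventually_elim
          case (elim k)
          have "1 + M - g (snd (q k)) \<le> 1 / fst (q k)"
            using qX(3)[of k] elim by (simp add: field_simps)
          then show ?case using qX(1)[of k] elim by simp
        qed
        then have "x \<in> {x \<in> X. c \<le> g x}"
          using Lim_in_closed_set[OF usc _ _ xl] by simp
        then show "c \<le> g x" by simp
      qed
      then show ?thesis using sp by (simp add: field_simps)
    qed simp
    then show "l \<in> Q" using l xX s0 by (simp add: Q_def)
  qed
  moreover have "Q \<subseteq> {0..1} \<times> X" using s1 by (auto simp: Q_def)
  ultimately have "compact Q"
    using compact_Times[OF compact_Icc X] bounded_subset compact_eq_bounded_closed by metis
  then have "compact P"
    unfolding P_def case_prod_unfold by (intro compact_continuous_image continuous_intros)
  then have clP: "closed (convex hull P)"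
    using compact_convex_hull compact_imp_closed by blast
  have conv: "convex (convex hull P)" by simp
  \<comment> \<open>\<open>D\<close> is the preimage of the closed hull of \<open>P\<close> under
    the projective map; \<open>\<mu> \<le> M\<close> keeps the denominator at least
    \<open>1\<close>. It remains to show that \<open>C = D\<close> and that \<open>D\<close> is
    closed.\<close>
  define D where "D = {(x, \<mu>). \<mu> \<le> M \<and> (1 / (1 + M - \<mu>), x /\<^sub>R (1 + M - \<mu>)) \<in> convex hull P}"
  have "C \<subseteq> D"
    unfolding C_def
  proof (rule hull_minimal)
    show "hyp X g \<subseteq> D"
    proof (clarsimp simp: hyp_def D_def)
      fix x \<mu> assume *: "\<mu> \<le> g x" "x \<in> X"
      then have "\<mu> \<le> M" using M[of x] by linarith
      moreover have "(1 / (1 + M - \<mu>), x) \<in> Q"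
        using * \<open>\<mu> \<le> M\<close> by (simp add: Q_def)
      then have "(1 / (1 + M - \<mu>), x /\<^sub>R (1 + M - \<mu>)) \<in> P"
        unfolding P_def by (force simp: divide_inverse image_iff)
      ultimately show "\<mu> \<le> M \<and> (1 / (1 + M - \<mu>), x /\<^sub>R (1 + M - \<mu>)) \<in> convex hull P"
        by (simp add: hull_inc)
    qed
    show "convex D"
    proof (rule convexI)
      fix p q u v assume p: "p \<in> D" and q: "q \<in> D" and uv: "0 \<le> (u::real)" "0 \<le> v" "u + v = 1"
      obtain x1 \<mu>1 x2 \<mu>2 where pq: "p = (x1, \<mu>1)" "q = (x2, \<mu>2)" by fastforce
      define r1 r2 r where "r1 = 1 + M - \<mu>1" and "r2 = 1 + M - \<mu>2" and "r = u * r1 + v * r2"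
      have r: "r1 \<ge> 1" "r2 \<ge> 1" using p q pq by (auto simp: D_def r1_def r2_def)
      have req: "r = 1 + M - (u * \<mu>1 + v * \<mu>2)"
      proof -
        have "r = (u + v) * (1 + M) - (u * \<mu>1 + v * \<mu>2)"
          by (simp add: r_def r1_def r2_def algebra_simps)
        then show ?thesis using uv by simp
      qed
      have "u * 1 + v * 1 \<le> r" unfolding r_def using uv r by (intro add_mono mult_left_mono)
      then have r1': "r \<ge> 1" using uv by simp
      \<comment> \<open>A projective map changes convex weights: they are rescaled by the
        denominators \<open>r1\<close> and \<open>r2\<close>.\<close>
      have "(u * r1 / r) *\<^sub>R (1 / r1, x1 /\<^sub>R r1) + (v * r2 / r) *\<^sub>R (1 / r2, x2 /\<^sub>R r2) \<in> convex hull P"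
        using p q pq r r1' uv
        by (intro convexD[OF conv])
           (auto simp: D_def r1_def r2_def add_divide_distrib[symmetric], simp_all add: r_def r1_def r2_def)
      also have "(u * r1 / r) *\<^sub>R (1 / r1, x1 /\<^sub>R r1) + (v * r2 / r) *\<^sub>R (1 / r2, x2 /\<^sub>R r2)
          = (1 / r, (u *\<^sub>R x1 + v *\<^sub>R x2) /\<^sub>R r)"
      proof -
        have "u * r1 / r * (1 / r1) + v * r2 / r * (1 / r2) = 1 / r"
          using r r1' uv by (simp add: add_divide_distrib[symmetric])
        moreover have "(u * r1 / r) *\<^sub>R (x1 /\<^sub>R r1) = u *\<^sub>R x1 /\<^sub>R r"
          "(v * r2 / r) *\<^sub>R (x2 /\<^sub>R r2) = v *\<^sub>R x2 /\<^sub>R r"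
          using r by (simp_all add: divide_inverse)
        ultimately show ?thesis
          by (simp only: scaleR_Pair add_Pair scaleR_add_right real_scaleR_def)
      qed
      finally show "u *\<^sub>R p + v *\<^sub>R q \<in> D"
        using req r1' pq by (simp add: D_def)
    qed
  qed
  moreover have "D \<subseteq> C"
  proof -
    define K where "K = {(s, y, w). 0 \<le> s \<and> (s = 0 \<longrightarrow> y = 0 \<and> w \<le> 0) \<and> (0 < s \<longrightarrow> (y /\<^sub>R s, w / s) \<in> C)}"
    have K: "convex_cone K"
      unfolding K_def C_def by (rule convex_cone_perspective) (auto intro: convex_hull_hyp_downward)
    \<comment> \<open>For \<open>s = 1 / (1 + M - \<mu>)\<close> the homogenized height
      \<open>s * \<mu>\<close> equals \<open>s * (1 + M) - 1\<close>, so inverting the projective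
      map means taking an affine section of \<open>K\<close>. The added point \<open>(0, 0)\<close>
      gets height \<open>-1\<close>, on the downward ray.\<close>
    define K' where "K' = {(s, y). (s, y, s * (1 + M) - 1) \<in> K}"
    have "convex K'"
    proof (rule convexI)
      fix p q u v assume p: "p \<in> K'" and q: "q \<in> K'" and uv: "0 \<le> (u::real)" "0 \<le> v" "u + v = 1"
      obtain s1 y1 s2 y2 where pq: "p = (s1, y1)" "q = (s2, y2)" by fastforce
      have "u *\<^sub>R (s1, y1, s1 * (1 + M) - 1) + v *\<^sub>R (s2, y2, s2 * (1 + M) - 1) \<in> K"
        using p q pq uv K by (intro convexD[of K]) (auto simp: K'_def convex_cone_def)
      moreover have "u * (s1 * (1 + M) - 1) + v * (s2 * (1 + M) - 1) = (u * s1 + v * s2) * (1 + M) - 1"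
        using uv(3) by (simp add: algebra_simps)
      ultimately show "u *\<^sub>R p + v *\<^sub>R q \<in> K'" by (simp add: K'_def pq)
    qed
    moreover have "P \<subseteq> K'"
    proof (clarsimp simp: P_def Q_def K'_def K_def)
      fix s x assume *: "x \<in> X" "0 < s" "s * (1 + M - g x) \<le> 1"
      then have "(s * (1 + M) - 1) / s \<le> g x" by (simp add: field_simps)
      then show "(x, (s * (1 + M) - 1) / s) \<in> C"
        unfolding C_def using * by (intro hull_inc) (simp add: hyp_def)
    qed
    ultimately have PK: "convex hull P \<subseteq> K'" by (rule hull_minimal[rotated])
    show ?thesis
    proof (clarsimp simp: D_def)
      fix x \<mu> assume "\<mu> \<le> M" and "(1 / (1 + M - \<mu>), x /\<^sub>R (1 + M - \<mu>)) \<in> convex hull P"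
      then have "(1 / (1 + M - \<mu>), x /\<^sub>R (1 + M - \<mu>)) \<in> K'" using PK by blast
      moreover define r where "r = 1 + M - \<mu>"
      ultimately have "((x /\<^sub>R r) /\<^sub>R (1 / r), (1 / r * (1 + M) - 1) / (1 / r)) \<in> C" and r: "r > 0"
        using \<open>\<mu> \<le> M\<close> by (auto simp: K'_def K_def)
      moreover have "(1 / r * (1 + M) - 1) / (1 / r) = \<mu>"
      proof -
        have "(1 / r * (1 + M) - 1) / (1 / r) = 1 + M - r" using r by (simp add: field_simps)
        then show ?thesis by (simp add: r_def)
      qed
      ultimately show "(x, \<mu>) \<in> C" by simp
    qed
  qed
  moreover have "closed D"
  proof -
    define Z where "Z = {p::'a \<times> real. snd p \<le> M}"
    have "closed Z" unfolding Z_def by (intro closed_Collect_le continuous_intros)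
    moreover have "continuous_on Z (\<lambda>p. (1 / (1 + M - snd p), fst p /\<^sub>R (1 + M - snd p)))"
      unfolding Z_def by (intro continuous_intros) auto
    ultimately have "closed (Z \<inter> (\<lambda>p. (1 / (1 + M - snd p), fst p /\<^sub>R (1 + M - snd p))) -` (convex hull P))"
      using clP by (simp add: continuous_closed_preimage)
    moreover have "D = Z \<inter> (\<lambda>p. (1 / (1 + M - snd p), fst p /\<^sub>R (1 + M - snd p))) -` (convex hull P)"
      by (auto simp: D_def Z_def)
    ultimately show ?thesis by simp
  qed
  ultimately show ?thesis unfolding C_def by (metis subset_antisym)
qed

section \<open>Polyhedral hypographs\<close>

text \<open>Each defining halfspace pulls back to a halfspace whose normal is given by the adjoint
  of \<open>h\<close>.\<close>

lemma polyhedron_affine_preimage: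
  fixes h :: "'a::euclidean_space \<Rightarrow> 'b::euclidean_space"
  assumes h: "linear h" and T: "polyhedron T"
  shows "polyhedron {x. h x + c \<in> T}"
proof -
  obtain \<H> where \<H>: "finite \<H>" "T = \<Inter>\<H>" "\<And>H. H \<in> \<H> \<Longrightarrow> \<exists>a b. H = {y. a \<bullet> y \<le> b}"
    using T unfolding polyhedron_def by metis
  have "polyhedron {x. h x + c \<in> H}" if H: "H \<in> \<H>" for H
  proof -
    obtain a b where "H = {y. a \<bullet> y \<le> b}" using \<H>(3)[OF H] by blast
    then have "{x. h x + c \<in> H} = {x. adjoint h a \<bullet> x \<le> b - a \<bullet> c}"
      by (simp add: inner_add_right adjoint_clauses[OF h] le_diff_eq)
    then show ?thesis by (simp add: polyhedron_halfspace_le)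
  qed
  then have "polyhedron (\<Inter>((\<lambda>H. {x. h x + c \<in> H}) ` \<H>))"
    using \<H>(1) by (intro polyhedron_Inter) auto
  also have "\<Inter>((\<lambda>H. {x. h x + c \<in> H}) ` \<H>) = {x. h x + c \<in> T}"
    using \<H>(2) by auto
  finally show ?thesis .
qed

text \<open>The hull is the slice at height \<open>1\<close> of a finitely generated cone.\<close>

lemma polyhedron_convex_hull_hyp:
  fixes V :: "'a::euclidean_space set" and g :: "'a \<Rightarrow> real"
  assumes V: "finite V"
  shows "polyhedron (convex hull (hyp V g))"
proof -
  \<comment> \<open>The generators are the lifted points at \<open>s = 1\<close> and the downward
    ray at \<open>s = 0\<close>.\<close>
  define G where "G = insert (0, 0, -1) ((\<lambda>v. (1::real, v, g v)) ` V)"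
  define C where "C = convex hull (hyp V g)"
  define K where "K = {(s, y, w). 0 \<le> s \<and> (s = 0 \<longrightarrow> y = 0 \<and> w \<le> 0) \<and> (0 < s \<longrightarrow> (y /\<^sub>R s, w / s) \<in> C)}"
  have "convex_cone K"
    unfolding K_def C_def by (rule convex_cone_perspective) (auto intro: convex_hull_hyp_downward)
  moreover have "G \<subseteq> K"
    by (auto simp: G_def K_def C_def hyp_def intro: hull_inc)
  ultimately have sub: "convex_cone hull G \<subseteq> K" by (rule hull_minimal[rotated])
  \<comment> \<open>The slice at \<open>s = 1\<close> is written as an affine preimage, the shape
    that \<open>polyhedron_affine_preimage\<close> expects.\<close>
  define D where "D = {p. (0::real, p) + (1, 0) \<in> convex_cone hull G}"
  have "convex D"
  proof (rule convexI)
    fix p q u v assume p: "p \<in> D" and q: "q \<in> D" and uv: "0 \<le> (u::real)" "0 \<le> v" "u + v = 1"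
    have "u *\<^sub>R (1, p) + v *\<^sub>R (1, q) \<in> convex_cone hull G"
      using p q uv by (intro convexD[OF convex_convex_cone_hull]) (auto simp: D_def)
    then show "u *\<^sub>R p + v *\<^sub>R q \<in> D" using uv by (simp add: D_def)
  qed
  moreover have "hyp V g \<subseteq> D"
  proof (clarsimp simp: hyp_def D_def)
    fix v \<nu> assume "\<nu> \<le> g v" "v \<in> V"
    then have "(1, v, g v) + (g v - \<nu>) *\<^sub>R (0, 0, -1) \<in> convex_cone hull G"
      by (intro convex_cone_add[OF convex_cone_convex_cone_hull] convex_cone_scaleR[OF convex_cone_convex_cone_hull] hull_inc)
         (auto simp: G_def)
    then show "(1, v, \<nu>) \<in> convex_cone hull G" by simp
  qed
  ultimately have "C \<subseteq> D" unfolding C_def by (rule hull_minimal[rotated])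
  moreover have "D \<subseteq> C" using sub by (auto simp: D_def K_def)
  ultimately have "C = D" by blast
  moreover have "polyhedron D"
    unfolding D_def
    by (intro polyhedron_affine_preimage polyhedron_convex_cone_hull)
       (auto simp: G_def V intro!: linearI)
  ultimately show ?thesis by (simp add: C_def)
qed

text \<open>
  The concave majorant that proves this is \<open>\<infinity>\<close> off the face \<open>T\<close> and the upper boundary of \<open>C\<close> on it;
  no proper convex combination of points of \<open>S\<close> enters \<open>T\<close> from outside.
\<close>

lemma conc_le_imp_in_closed_convex:
  fixes C :: "('b::real_normed_vector \<times> real) set"
  assumes L: "linear L" and S: "convex S" and T: "T face_of S"
    and C: "convex C" "closed C"
    and down: "\<And>x \<mu> \<nu>. (x, \<mu>) \<in> C \<Longrightarrow> \<nu> \<le> \<mu> \<Longrightarrow> (x, \<nu>) \<in> C"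
    and g: "\<And>y \<mu>. y \<in> T \<Longrightarrow> ereal \<mu> \<le> g y \<Longrightarrow> (L y, \<mu>) \<in> C"
    and z: "z \<in> T" "ereal \<mu> \<le> conc S g z"
  shows "(L z, \<mu>) \<in> C"
proof -
  define h where "h y = (if y \<in> T then SUP \<nu> \<in> {\<nu>. (L y, \<nu>) \<in> C}. ereal \<nu> else \<infinity>)" for y
  \<comment> \<open>Closedness of \<open>C\<close> makes a finite supremum attained, so over
    \<open>T\<close> the real hypograph of \<open>h\<close> is exactly the preimage of
    \<open>C\<close>.\<close>
  have h: "ereal \<nu> \<le> h y \<longleftrightarrow> (L y, \<nu>) \<in> C" if "y \<in> T" for y \<nu>
  proof
    assume "(L y, \<nu>) \<in> C" then show "ereal \<nu> \<le> h y"
      using that by (auto simp: h_def intro: SUP_upper)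
  next
    assume le: "ereal \<nu> \<le> h y"
    have "(L y, \<nu> - 1 / real (Suc k)) \<in> C" for k
    proof -
      have "ereal (\<nu> - 1 / real (Suc k)) < ereal \<nu>" by simp
      also note le
      finally have "ereal (\<nu> - 1 / real (Suc k)) < (SUP \<nu> \<in> {\<nu>. (L y, \<nu>) \<in> C}. ereal \<nu>)"
        using that by (simp only: h_def if_True)
      then obtain \<nu>' where "(L y, \<nu>') \<in> C" "\<nu> - 1 / real (Suc k) < \<nu>'"
        unfolding less_SUP_iff by auto
      then show ?thesis using down by (meson less_imp_le)
    qed
    moreover have "(\<lambda>k. (L y, \<nu> - 1 / real (Suc k))) \<longlonglongrightarrow> (L y, \<nu> - 0)"
      by (intro tendsto_intros LIMSEQ_Suc lim_1_over_n)
    ultimately show "(L y, \<nu>) \<in> C"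
      using closed_sequentially[OF C(2)] by fastforce
  qed
  have "ereal_concave_on S h"
    unfolding ereal_concave_on_def
  proof (rule convexI)
    let ?D = "{(x, \<mu>::real). x \<in> S \<and> ereal \<mu> \<le> h x}"
    fix p q u v assume p: "p \<in> ?D" and q: "q \<in> ?D" and uv: "0 \<le> (u::real)" "0 \<le> v" "u + v = 1"
    obtain x1 m1 x2 m2 where pq: "p = (x1, m1)" "q = (x2, m2)" by fastforce
    let ?x = "u *\<^sub>R x1 + v *\<^sub>R x2" and ?m = "u * m1 + v * m2"
    have xS: "?x \<in> S" using p q pq uv by (auto intro!: convexD[OF S])
    have "ereal ?m \<le> h ?x"
    \<comment> \<open>A trivial combination returns an endpoint, and off \<open>T\<close> the value
      is \<open>\<infinity>\<close>; the face property handles proper combinations landing in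
      \<open>T\<close>.\<close>
    proof (cases "u = 0 \<or> v = 0 \<or> ?x \<notin> T")
      case True then show ?thesis using p q pq uv by (auto simp: h_def)
    next
      case False
      have "x1 \<in> T \<and> x2 \<in> T"
      proof (cases "x1 = x2")
        case True
        then have "?x = x1" using uv by (simp add: scaleR_add_left[symmetric])
        then show ?thesis using False True by simp
      next
        case neq: False
        have "?x \<in> open_segment x1 x2"
          unfolding in_segment using uv False neq by (intro conjI exI[of _ v]) (auto simp: eq_diff_eq[symmetric])
        then show ?thesis using face_ofD[OF T] False p q pq by auto
      qed
      then have "u *\<^sub>R (L x1, m1) + v *\<^sub>R (L x2, m2) \<in> C"
        using p q pq h uv by (intro convexD[OF C(1)]) auto
      then show ?thesis using h[of ?x] False by (simp add: linear_add[OF L] linear_scale[OF L])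
    qed
    then show "u *\<^sub>R p + v *\<^sub>R q \<in> ?D" using xS pq by simp
  qed
  moreover have "g y \<le> h y" for y
  proof (cases "y \<in> T")
    case True
    show ?thesis
    proof (rule ccontr)
      assume "\<not> g y \<le> h y"
      \<comment> \<open>The assumption on \<open>g\<close> speaks of real heights, so a real is
        inserted between the two extended values.\<close>
      then obtain r where "h y < ereal r" "ereal r < g y" using ereal_dense2 not_le by metis
      then show False using g[OF True, of r] h[OF True, of r] by simp
    qed
  qed (simp add: h_def)
  ultimately have "conc S g z \<le> h z" by (intro conc_least)
  then show ?thesis using z h by (meson order_trans)
qed

section \<open>The product of simplices and its faces\<close>

lemma polyhedron_linear_le:
  fixes h :: "'a::euclidean_space \<Rightarrow> real"
  assumes "linear h"
  shows "polyhedron {x. h x \<le> c}"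
proof -
  have "polyhedron {y::real. 1 \<bullet> y \<le> c}" by (rule polyhedron_halfspace_le)
  from polyhedron_affine_preimage[OF assms this, of 0] show ?thesis by simp
qed

lemma polyhedron_linear_eq:
  fixes h :: "'a::euclidean_space \<Rightarrow> 'b::euclidean_space"
  assumes "linear h"
  shows "polyhedron {x. h x = c}"
  using polyhedron_affine_preimage[OF assms, of "{c}" 0] by (simp add: polytope_imp_polyhedron polytope_sing)

lemma polyhedron_Collect_conj:
  "polyhedron {x. P x} \<Longrightarrow> polyhedron {x. Q x} \<Longrightarrow> polyhedron {x. P x \<and> Q x}"
  by (simp add: Collect_conj_eq polyhedron_Int)

lemma polyhedron_Collect_ball:
  assumes "finite I" "\<And>i. i \<in> I \<Longrightarrow> polyhedron {x. P i x}"
  shows "polyhedron {x. \<forall>i\<in>I. P i x}"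
proof -
  have "{x. \<forall>i\<in>I. P i x} = \<Inter>((\<lambda>i. {x. P i x}) ` I)" by auto
  then show ?thesis using assms by auto
qed

section \<open>Coordinates and faces of the product of simplices\<close>

definition array :: "nat \<Rightarrow> ('d \<Rightarrow> nat \<Rightarrow> real) \<Rightarrow> real ^ 'k::{finite, linorder} ^ 'd" where
  "array n x = (\<chi> i k. x i (inv_into {..n} idx k))"

text \<open>Since rows are nonincreasing, the entry \<open>1\<close> at \<open>p i\<close> forces
  all earlier entries to be \<open>1\<close>: this is the face with ones up to \<open>p i\<close>
  and zeros after \<open>q i\<close>.\<close>

definition slab :: "nat \<Rightarrow> ('d \<Rightarrow> nat) \<Rightarrow> ('d \<Rightarrow> nat) \<Rightarrow> (real ^ 'k::{finite, linorder} ^ 'd) set" where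
  "slab n p q = {z \<in> Delta n. \<forall>i. z $ i $ idx (p i) = 1 \<and> (\<forall>j. q i < j \<longrightarrow> j \<le> n \<longrightarrow> z $ i $ idx j = 0)}"

lemma bij_betw_idx:
  assumes "CARD('k::{finite, linorder}) = n + 1"
  shows "bij_betw (idx :: nat \<Rightarrow> 'k) {..n} UNIV"
proof -
  have "bij_betw ((!) (sorted_list_of_set (UNIV :: 'k set))) {..n} UNIV"
    by (rule bij_betw_nth) (auto simp: assms)
  then show ?thesis by (simp add: idx_def[abs_def])
qed

lemma linear_F: "linear (F n a)"
  by (rule linearI)
     (auto simp: F_def vec_eq_iff distrib_left sum.distrib sum_distrib_left mult.left_commute)

lemma linear_nth_nth: "linear (\<lambda>z :: real ^ 'k::finite ^ 'd::finite. z $ i $ k)"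
  by (rule linearI) auto

lemma Delta_antimono:
  assumes "z \<in> Delta n" "j \<le> m" "m \<le> n"
  shows "z $ i $ idx m \<le> z $ i $ idx j"
  using assms(2,3)
proof (induction m rule: dec_induct)
  case (step m)
  have "z $ i $ idx (Suc m) \<le> z $ i $ idx m" using assms(1) step.prems by (simp add: Delta_def)
  then show ?case using step by simp
qed simp

lemma Delta_bounds:
  assumes "z \<in> Delta n" "j \<le> n"
  shows "0 \<le> z $ i $ idx j" "z $ i $ idx j \<le> 1"
  using Delta_antimono[OF assms(1), of j n i] Delta_antimono[OF assms(1), of 0 j i] assms
  by (auto simp: Delta_def intro: order_trans)

lemma polyhedron_Delta: "polyhedron (Delta n :: (real ^ 'k::{finite, linorder} ^ 'd::finite) set)"
proof -
  have "Delta n = {z :: real ^ 'k::{finite, linorder} ^ 'd. \<forall>i\<in>UNIV. z $ i $ idx 0 = 1 \<and>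
      (\<forall>j\<in>{..<n}. z $ i $ idx (Suc j) - z $ i $ idx j \<le> 0) \<and> - z $ i $ idx n \<le> 0}"
    by (auto simp: Delta_def)
  also have "polyhedron \<dots>"
    by (intro polyhedron_Collect_ball polyhedron_Collect_conj polyhedron_linear_le polyhedron_linear_eq
          linear_nth_nth linear_compose_sub linear_compose_neg) auto
  finally show ?thesis .
qed

text \<open>On \<open>Delta\<close> all entries lie between \<open>0\<close> and \<open>1\<close>,
  so an interior point of a segment has an entry at one of these bounds only if both endpoints
  do.\<close>

lemma slab_face_of_Delta:
  assumes p: "\<And>i. p i \<le> n"
  shows "slab n p q face_of (Delta n :: (real ^ 'k::{finite, linorder} ^ 'd::finite) set)"
  unfolding face_of_def
proof (intro conjI ballI impI)
  show "slab n p q \<subseteq> (Delta n :: (real ^ 'k::{finite, linorder} ^ 'd) set)" by (auto simp: slab_def)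
  show "convex (slab n p q :: (real ^ 'k::{finite, linorder} ^ 'd) set)"
  proof (rule convexI)
    fix x y :: "real ^ 'k::{finite, linorder} ^ 'd" and u v :: real
    assume xy: "x \<in> slab n p q" "y \<in> slab n p q" and uv: "0 \<le> u" "0 \<le> v" "u + v = 1"
    have "u *\<^sub>R x + v *\<^sub>R y \<in> Delta n"
      using xy uv by (intro convexD[OF polyhedron_imp_convex[OF polyhedron_Delta]]) (auto simp: slab_def)
    then show "u *\<^sub>R x + v *\<^sub>R y \<in> slab n p q"
      using xy uv by (simp add: slab_def)
  qed
next
  have main: "x \<in> slab n p q"
    if x: "x \<in> Delta n" and y: "y \<in> Delta n" and z: "(1 - u) *\<^sub>R x + u *\<^sub>R y \<in> slab n p q" and u: "0 < u" "u < 1"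
    for x y :: "real ^ 'k::{finite, linorder} ^ 'd" and u
  proof -
    have "x $ i $ idx (p i) = 1" for i
    proof (rule ccontr)
      assume "x $ i $ idx (p i) \<noteq> 1"
      then have "x $ i $ idx (p i) < 1" using Delta_bounds(2)[OF x p, where i1 = i and i = i] by simp
      then have "(1 - u) * x $ i $ idx (p i) + u * y $ i $ idx (p i) < (1 - u) * 1 + u * 1"
        using Delta_bounds(2)[OF y p, where i1 = i and i = i] u
        by (intro add_less_le_mono mult_strict_left_mono mult_left_mono) auto
      moreover have "(1 - u) * x $ i $ idx (p i) + u * y $ i $ idx (p i) = 1"
        using z by (simp add: slab_def)
      ultimately show False by simp
    qed
    moreover have "x $ i $ idx j = 0" if j: "q i < j" "j \<le> n" for i j
    proof -
      have "(1 - u) * x $ i $ idx j + u * y $ i $ idx j = 0"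
        using z j by (simp add: slab_def)
      moreover have "0 \<le> (1 - u) * x $ i $ idx j" "0 \<le> u * y $ i $ idx j"
        using Delta_bounds(1)[OF x j(2)] Delta_bounds(1)[OF y j(2)] u by simp_all
      ultimately have "(1 - u) * x $ i $ idx j = 0" by linarith
      then show ?thesis using u by simp
    qed
    ultimately show ?thesis using x by (simp add: slab_def)
  qed
  fix x y z :: "real ^ 'k::{finite, linorder} ^ 'd"
  assume x: "x \<in> Delta n" and y: "y \<in> Delta n" and "z \<in> slab n p q" "z \<in> open_segment x y"
  then obtain u where u: "0 < u" "u < 1" and z: "(1 - u) *\<^sub>R x + u *\<^sub>R y \<in> slab n p q"
    by (auto simp: in_segment)
  show "x \<in> slab n p q" using main[OF x y z u] .
  show "y \<in> slab n p q" using main[OF y x, of "1 - u"] z u by (simp add: add.commute)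
qed

text \<open>With \<open>a 0\<close> added back, this is the value of \<open>F\<close> on a row of
  ones up to \<open>p\<close> followed by zeros: the breakpoint \<open>a p\<close>.\<close>

lemma telescope_upto:
  fixes a :: "nat \<Rightarrow> real"
  assumes "p \<le> n"
  shows "(\<Sum>j=1..n. (a j - a (j - 1)) * of_bool (j \<le> p)) = a p - a 0"
proof -
  have "(\<Sum>j=1..n. (a j - a (j - 1)) * of_bool (j \<le> p)) = (\<Sum>j=1..p. a j - a (j - 1))"
    using assms by (intro sum.mono_neutral_cong_right) auto
  also have "\<dots> = a p - a 0"
    by (induction p) auto
  finally show ?thesis .
qed

text \<open>
  A row with an entry \<open>c\<close> in \<open>(0, 1)\<close> splits because \<open>x = c min {1, x / c} + (1 - c) max {0, (x - c) / (1 - c)}\<close>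
  with both functions monotone and fixing \<open>1\<close>.
\<close>

lemma vert_Delta_binary:
  fixes v :: "real ^ 'k::{finite, linorder} ^ 'd::finite"
  assumes v: "v \<in> vert (Delta n)" and j: "j \<le> n"
  shows "v $ i $ idx j \<in> {0, 1}"
proof (rule ccontr)
  have vD: "v \<in> Delta n" using v by (simp add: vert_def extreme_point_of_def)
  define c where "c = v $ i $ idx j"
  assume "v $ i $ idx j \<notin> {0, 1}"
  then have c: "0 < c" "c < 1"
    using Delta_bounds[OF vD j, of i] by (auto simp: c_def)
  define f where "f x = min 1 (x / c)" for x
  define g where "g x = max 0 ((x - c) / (1 - c))" for x
  \<comment> \<open>Only row \<open>i\<close> is changed; \<open>mono h\<close>,
    \<open>h 1 = 1\<close> and \<open>0 \<le> h 0\<close> keep the result in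
    \<open>Delta\<close>.\<close>
  define w where "w h = (\<chi> i' k. if i' = i then h (v $ i' $ k) else v $ i' $ k)" for h :: "real \<Rightarrow> real"
  have D: "w h \<in> Delta n" if "mono h" "h 1 = 1" "0 \<le> h 0" for h
  proof -
    have "0 \<le> h (v $ i $ idx n)" using Delta_bounds(1)[OF vD, of n i] that monoD[OF that(1)] order_trans by blast
    then show ?thesis using vD that by (auto simp: w_def Delta_def monoD)
  qed
  have "mono f" "mono g"
    unfolding f_def g_def using c by (intro monoI min.mono max.mono order_refl divide_right_mono; simp)+
  then have "w f \<in> Delta n" "w g \<in> Delta n" using c by (auto intro!: D simp: f_def g_def)
  moreover have "v \<in> open_segment (w g) (w f)"
  proof -
    have "(1 - c) * g x + c * f x = x" for x
      using c by (cases "x \<le> c") (auto simp: f_def g_def min_def max_def field_simps)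
    then have "v = (1 - c) *\<^sub>R w g + c *\<^sub>R w f"
      by (auto simp: vec_eq_iff w_def algebra_simps)
    \<comment> \<open>The entry \<open>j\<close> of \<open>v\<close> is \<open>c\<close>, where
      \<open>g\<close> gives \<open>0\<close> and \<open>f\<close> gives \<open>1\<close>, so the
      endpoints differ.\<close>
    moreover have "w g $ i $ idx j \<noteq> w f $ i $ idx j"
      using c by (simp add: w_def f_def g_def c_def[symmetric])
    ultimately show ?thesis using c by (auto simp: in_segment)
  qed
  ultimately show False using v by (auto simp: vert_def extreme_point_of_def)
qed

section \<open>The incremental formulation\<close>

text \<open>\<open>K\<close> makes the type of the column indices a parameter, since the types of
  the other parameters do not mention it.\<close>

locale incremental =
  fixes n :: nat
    and a :: "'d::finite \<Rightarrow> nat \<Rightarrow> real"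
    and \<tau> :: "'d \<Rightarrow> nat \<Rightarrow> nat"
    and l :: "'d \<Rightarrow> nat"
    and \<phi> :: "real ^ 'd \<Rightarrow> real"
    and K :: "'k::{finite, linorder} itself"
  assumes card: "CARD('k) = n + 1" and n: "n \<ge> 1"
    and a: "\<And>i j. j < n \<Longrightarrow> a i j < a i (j + 1)"
    and \<tau>_0: "\<And>i. \<tau> i 0 = 0"
    and \<tau>_less: "\<And>i t. t < l i \<Longrightarrow> \<tau> i t < \<tau> i (t + 1)"
    and \<tau>_l: "\<And>i. \<tau> i (l i) = n"
begin

abbreviation g :: "real ^ 'k::{finite, linorder} ^ 'd \<Rightarrow> ereal" where
  "g z \<equiv> ereal (\<phi> (F n a z))"

abbreviation cell :: "('d \<Rightarrow> nat) \<Rightarrow> (real ^ 'd) set" where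
  "cell t \<equiv> cbox (\<chi> i. a i (\<tau> i (t i - 1))) (\<chi> i. a i (\<tau> i (t i)))"

abbreviation piece :: "('d \<Rightarrow> nat) \<Rightarrow> (real ^ 'k::{finite, linorder} ^ 'd) set" where
  "piece t \<equiv> slab n (\<lambda>i. \<tau> i (t i - 1)) (\<lambda>i. \<tau> i (t i))"

abbreviation E :: "(((real ^ 'd) \<times> real) \<times> (real ^ 'k::{finite, linorder} ^ 'd) \<times> (real ^ ('d \<times> 'k::{finite, linorder}))) set" where
  "E \<equiv> formulation {0, 1} n a \<tau> l \<phi>"

abbreviation R :: "(((real ^ 'd) \<times> real) \<times> (real ^ 'k::{finite, linorder} ^ 'd) \<times> (real ^ ('d \<times> 'k::{finite, linorder}))) set" where
  "R \<equiv> formulation {0..1} n a \<tau> l \<phi>"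

lemma array_nth: "j \<le> n \<Longrightarrow> (array n x :: real ^ 'k::{finite, linorder} ^ 'd) $ i $ idx j = x i j"
  using bij_betw_idx[OF card] by (simp add: array_def inv_into_f_f bij_betw_def)

lemma idx_eq_iff: "j \<le> n \<Longrightarrow> k \<le> n \<Longrightarrow> (idx j :: 'k) = idx k \<longleftrightarrow> j = k"
  using bij_betw_idx[OF card] by (auto simp: bij_betw_def dest: inj_onD)

lemma a_less: "j < k \<Longrightarrow> k \<le> n \<Longrightarrow> a i j < a i k"
proof (induction k)
  case (Suc k)
  then show ?case using a[of k i] by (cases "j = k") auto
qed simp

lemma a_mono: "j \<le> k \<Longrightarrow> k \<le> n \<Longrightarrow> a i j \<le> a i k"
  using a_less[of j k i] by (cases "j = k") auto

lemma \<tau>_mono: "s \<le> t \<Longrightarrow> t \<le> l i \<Longrightarrow> \<tau> i s \<le> \<tau> i t"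
proof (induction t rule: dec_induct)
  case (step t)
  then show ?case using \<tau>_less[of t i] by simp
qed simp

lemma \<tau>_le_n: "t \<le> l i \<Longrightarrow> \<tau> i t \<le> n"
  using \<tau>_mono[of t "l i" i] \<tau>_l by simp

lemma \<tau>_less_n: "t < l i \<Longrightarrow> \<tau> i t < n"
  using \<tau>_less[of t i] \<tau>_le_n[of "t + 1" i] by simp

lemma l_pos: "1 \<le> l i"
  using \<tau>_0[of i] \<tau>_l[of i] n by (cases "l i = 0") auto

text \<open>Strictly increasing integers starting at \<open>0\<close> are at least \<open>t\<close>
  after \<open>t\<close> steps. Hence \<open>l i \<le> n\<close>, which keeps the positions of the
  binary variables where \<open>idx\<close> is injective.\<close>

lemma le_\<tau>: "t \<le> l i \<Longrightarrow> t \<le> \<tau> i t"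
proof (induction t)
  case (Suc t)
  then show ?case using \<tau>_less[of t i] by simp
qed simp

lemma l_le_n: "l i \<le> n"
  using le_\<tau>[of "l i" i] \<tau>_l by simp

section \<open>Images of faces under \<open>F\<close>\<close>

text \<open>Each row lies entrywise between the step rows with ones up to \<open>p i\<close> and up
  to \<open>q i\<close>. The increments of \<open>a\<close> are nonnegative, so the sums compare,
  and those of the step rows telescope.\<close>

lemma F_slab_bounds:
  fixes z :: "real ^ 'k::{finite, linorder} ^ 'd"
  assumes z: "z \<in> slab n p q" and pq: "\<And>i. p i \<le> n" "\<And>i. q i \<le> n"
  shows "F n a z \<in> cbox (\<chi> i. a i (p i)) (\<chi> i. a i (q i))"
proof -
  have zD: "z \<in> Delta n" using z by (simp add: slab_def)
  have z0: "z $ i $ idx 0 = 1" for i using zD by (simp add: Delta_def)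
  have d: "0 \<le> a i j - a i (j - 1)" if "j \<in> {1..n}" for i j
    using a_mono[of "j - 1" j i] that by simp
  have "a i (p i) - a i 0 \<le> (\<Sum>j=1..n. (a i j - a i (j - 1)) * z $ i $ idx j)" for i
    unfolding telescope_upto[OF pq(1)[of i], of "a i", symmetric]
  proof (intro sum_mono mult_left_mono d)
    fix j assume j: "j \<in> {1..n}"
    show "of_bool (j \<le> p i) \<le> z $ i $ idx j"
    proof (cases "j \<le> p i")
      case True
      then show ?thesis using Delta_antimono[OF zD True pq(1), of i] z by (simp add: slab_def)
    qed (use Delta_bounds(1)[OF zD, of j i] j in auto)
  qed
  moreover have "(\<Sum>j=1..n. (a i j - a i (j - 1)) * z $ i $ idx j) \<le> a i (q i) - a i 0" for i
    unfolding telescope_upto[OF pq(2)[of i], of "a i", symmetric]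
  proof (intro sum_mono mult_left_mono d)
    fix j assume "j \<in> {1..n}"
    then show "z $ i $ idx j \<le> of_bool (j \<le> q i)"
      using z Delta_bounds(2)[OF zD, of j i] by (auto simp: slab_def)
  qed
  ultimately show ?thesis by (simp add: mem_box_cart F_def z0 algebra_simps)
qed

text \<open>In each row, mix the step rows with ones up to \<open>p i\<close> and up to
  \<open>q i\<close> according to the relative position \<open>\<theta> i\<close> of
  \<open>f $ i\<close> between the two breakpoints.\<close>

lemma F_slab_surj:
  assumes f: "f \<in> cbox (\<chi> i. a i (p i)) (\<chi> i. a i (q i))"
    and pq: "\<And>i. p i < q i" "\<And>i. q i \<le> n"
  obtains z :: "real ^ 'k::{finite, linorder} ^ 'd" where "z \<in> slab n p q" "F n a z = f"
proof -
  define \<theta> where "\<theta> i = (f $ i - a i (p i)) / (a i (q i) - a i (p i))" for i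
  define z :: "real ^ 'k::{finite, linorder} ^ 'd" where
    "z = array n (\<lambda>i j. (1 - \<theta> i) * of_bool (j \<le> p i) + \<theta> i * of_bool (j \<le> q i))"
  have pn: "p i \<le> n" for i using pq[of i] by simp
  have pos: "a i (p i) < a i (q i)" for i using a_less pq by blast
  have \<theta>: "0 \<le> \<theta> i" "\<theta> i \<le> 1" for i
    using f pos[of i] by (auto simp: \<theta>_def mem_box_cart)
  have nth: "z $ i $ idx j = (1 - \<theta> i) * of_bool (j \<le> p i) + \<theta> i * of_bool (j \<le> q i)" if "j \<le> n" for i j
    using that by (simp add: z_def array_nth)
  have "z \<in> slab n p q"
    using \<theta> pq pn less_trans[OF pq(1)] by (fastforce simp: slab_def Delta_def nth less_imp_le)
  moreover have "F n a z $ i = f $ i" for i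
  proof -
    have "(\<Sum>j=1..n. (a i j - a i (j - 1)) * z $ i $ idx j)
        = (\<Sum>j=1..n. (1 - \<theta> i) * ((a i j - a i (j - 1)) * of_bool (j \<le> p i))
            + \<theta> i * ((a i j - a i (j - 1)) * of_bool (j \<le> q i)))"
      by (intro sum.cong refl) (simp add: nth algebra_simps)
    also have "\<dots> = (1 - \<theta> i) * (a i (p i) - a i 0) + \<theta> i * (a i (q i) - a i 0)"
      by (simp only: sum.distrib sum_distrib_left[symmetric] telescope_upto[OF pn] telescope_upto[OF pq(2)])
    finally have "F n a z $ i = a i (p i) + \<theta> i * (a i (q i) - a i (p i))"
      by (simp add: F_def nth algebra_simps)
    then show ?thesis using pos[of i] by (simp add: \<theta>_def)
  qed
  ultimately show ?thesis using that by (simp add: vec_eq_iff)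
qed

section \<open>Binary points and pieces\<close>

lemma E_eq: "E = R \<inter> (UNIV \<times> UNIV \<times> binary)"
proof (intro set_eqI iffI)
  fix p :: "((real ^ 'd) \<times> real) \<times> (real ^ 'k::{finite, linorder} ^ 'd) \<times> (real ^ ('d \<times> 'k::{finite, linorder}))"
  obtain f \<mu> z \<delta> where p: "p = ((f, \<mu>), z, \<delta>)" by (metis prod.exhaust)
  assume "p \<in> E"
  then have 1: "\<delta> $ (i, idx t) \<in> {0, 1}" if "t \<in> {1..<l i}" for i t
    using that by (auto simp: p formulation_def)
  from \<open>p \<in> E\<close> have 2: "\<delta> $ (i, k) = 0" if "k \<notin> idx ` {1..<l i}" for i k
    using that by (auto simp: p formulation_def)
  have "\<delta> $ k \<in> {0, 1}" for k
  proof (cases k)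
    case (Pair i j)
    show ?thesis unfolding Pair using 1[of _ i] 2[of j i] by (cases "j \<in> idx ` {1..<l i}") (use 1 in blast)+
  qed
  then show "p \<in> R \<inter> (UNIV \<times> UNIV \<times> binary)"
    using \<open>p \<in> E\<close> by (auto simp: p formulation_def binary_def) (metis order_refl zero_le_one)+
next
  fix p :: "((real ^ 'd) \<times> real) \<times> (real ^ 'k::{finite, linorder} ^ 'd) \<times> (real ^ ('d \<times> 'k::{finite, linorder}))"
  assume "p \<in> R \<inter> (UNIV \<times> UNIV \<times> binary)"
  then show "p \<in> E" by (auto simp: formulation_def binary_def)
qed

text \<open>Take \<open>t i\<close> as the first index whose binary variable is \<open>0\<close>.
  The preceding variable is \<open>1\<close> and lifts the entry at its breakpoint to
  \<open>1\<close>; the zero variable and monotonicity clear all entries after the next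
  breakpoint.\<close>

lemma E_imp_piece:
  assumes "((f, \<mu>), z, \<delta>) \<in> E"
  obtains t where "\<And>i. t i \<in> {1..l i}" "z \<in> piece t"
proof -
  have zD: "z \<in> Delta n"
    and \<delta>: "\<And>i t. t \<in> {1..<l i} \<Longrightarrow> \<delta> $ (i, idx t) \<in> {0, 1} \<and> \<delta> $ (i, idx t) \<le> z $ i $ idx (\<tau> i t)
      \<and> z $ i $ idx (\<tau> i t + 1) \<le> \<delta> $ (i, idx t)"
    using assms by (auto simp: formulation_def)
  \<comment> \<open>The index \<open>l i\<close> has no variable and serves as default. At the ends,
    \<open>t i = 1\<close> relies on the fixed entry at \<open>\<tau> i 0 = 0\<close>, and
    \<open>t i = l i\<close> leaves no entry to clear.\<close>
  define P where "P i t \<longleftrightarrow> 1 \<le> t \<and> (t < l i \<longrightarrow> \<delta> $ (i, idx t) = 0)" for i t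
  define t where "t i = (LEAST t. P i t)" for i
  have Pl: "P i (l i)" for i using l_pos by (simp add: P_def)
  have Pt: "P i (t i)" for i unfolding t_def using Pl by (rule LeastI)
  have tl: "t i \<le> l i" for i unfolding t_def using Pl by (rule Least_le)
  have t1: "1 \<le> t i" for i using Pt[of i] by (simp add: P_def)
  have "z $ i $ idx (\<tau> i (t i - 1)) = 1" for i
  proof (cases "t i = 1")
    case True then show ?thesis using zD by (simp add: \<tau>_0 Delta_def)
  next
    case False
    then have *: "t i - 1 \<in> {1..<l i}" using t1[of i] tl[of i] by auto
    have "\<not> P i (t i - 1)" using not_less_Least[of "t i - 1" "P i"] t1[of i] by (simp add: t_def)
    then have "1 \<le> z $ i $ idx (\<tau> i (t i - 1))" using * \<delta>[OF *] by (auto simp: P_def)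
    then show ?thesis
      using Delta_bounds(2)[OF zD \<tau>_le_n, of "t i - 1" i i] tl[of i] by simp
  qed
  moreover have "z $ i $ idx j = 0" if j: "\<tau> i (t i) < j" "j \<le> n" for i j
  proof -
    have "t i \<noteq> l i" using j \<tau>_l[of i] by auto
    then have *: "t i \<in> {1..<l i}" using tl[of i] t1[of i] by auto
    then have "z $ i $ idx (\<tau> i (t i) + 1) \<le> 0" using Pt[of i] \<delta>[OF *] by (simp add: P_def)
    then show ?thesis
      using Delta_antimono[OF zD, of "\<tau> i (t i) + 1" j i] Delta_bounds(1)[OF zD j(2), of i] j by simp
  qed
  ultimately have "z \<in> piece t" using zD by (simp add: slab_def)
  moreover have "t i \<in> {1..l i}" for i using t1 tl by simp
  ultimately show ?thesis using that by blast
qed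

lemma piece_imp_E:
  fixes z :: "real ^ 'k::{finite, linorder} ^ 'd"
  assumes t: "\<And>i. t i \<in> {1..l i}" and z: "z \<in> piece t" and \<mu>: "ereal \<mu> \<le> conc (Delta n) g z"
  shows "(F n a z, \<mu>) \<in> fst ` E"
proof -
  define \<delta> :: "real ^ ('d \<times> 'k::{finite, linorder})" where
    "\<delta> = (\<chi> ik. of_bool (\<exists>s\<in>{1..<l (fst ik)}. snd ik = idx s \<and> s < t (fst ik)))"
  have zD: "z \<in> Delta n" using z by (simp add: slab_def)
  have \<delta>: "\<delta> $ (i, idx s) = of_bool (s < t i)" if "s \<in> {1..<l i}" for i s
  proof -
    have "(\<exists>s'\<in>{1..<l i}. (idx s :: 'k) = idx s' \<and> s' < t i) \<longleftrightarrow> s < t i"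
      using that idx_eq_iff[of s] l_le_n[of i] by force
    then show ?thesis by (simp add: \<delta>_def)
  qed
  have "((F n a z, \<mu>), z, \<delta>) \<in> E"
    unfolding formulation_def
  proof (clarsimp, intro conjI allI impI ballI \<mu> zD)
    fix i and s assume s: "s \<in> {Suc 0..<l i}"
    show "\<delta> $ (i, idx s) = 0 \<or> \<delta> $ (i, idx s) = 1" using \<delta>[of s i] s by simp
    show "\<delta> $ (i, idx s) \<le> z $ i $ idx (\<tau> i s)"
    proof (cases "s < t i")
      case True
      have "\<tau> i s \<le> \<tau> i (t i - 1)" using True t[of i] by (intro \<tau>_mono) auto
      then have "z $ i $ idx (\<tau> i (t i - 1)) \<le> z $ i $ idx (\<tau> i s)"
        using t[of i] by (intro Delta_antimono[OF zD] \<tau>_le_n) auto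
      then show ?thesis using z \<delta>[of s i] s by (simp add: slab_def)
    next
      case False
      then show ?thesis using \<delta>[of s i] s Delta_bounds(1)[OF zD \<tau>_le_n, of s i i] by simp
    qed
    show "z $ i $ idx (Suc (\<tau> i s)) \<le> \<delta> $ (i, idx s)"
    proof (cases "s < t i")
      case True
      then show ?thesis
        using \<delta>[of s i] s Delta_bounds(2)[OF zD, of "Suc (\<tau> i s)" i] \<tau>_less_n[of s i] by simp
    next
      case False
      then have "\<tau> i (t i) \<le> \<tau> i s" using s by (intro \<tau>_mono) auto
      then show ?thesis using False z \<delta>[of s i] s \<tau>_less_n[of s i] by (simp add: slab_def)
    qed
  next
    fix i k assume "k \<notin> (idx ` {Suc 0..<l i} :: 'k set)"
    then show "\<delta> $ (i, k) = 0" by (auto simp: \<delta>_def)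
  qed
  then show ?thesis by (force simp: image_iff)
qed

text \<open>The hypograph of the envelope over a piece is convex, so its linear image is a convex
  set; it contains \<open>hyp (cell t) \<phi>\<close> because the envelope overestimates and
  \<open>F\<close> is onto the cell.\<close>

lemma convex_hull_hyp_subset_fst_E:
  assumes t: "\<And>i. t i \<in> {1..l i}"
  shows "convex hull (hyp (cell t) \<phi>) \<subseteq> fst ` E"
proof -
  define A :: "((real ^ 'k::{finite, linorder} ^ 'd) \<times> real) set"
    where "A = {(z, \<mu>). z \<in> Delta n \<and> ereal \<mu> \<le> conc (Delta n) g z} \<inter> (piece t \<times> UNIV)"
  have tn: "\<tau> i (t i - 1) \<le> n" "\<tau> i (t i - 1) < \<tau> i (t i)" "\<tau> i (t i) \<le> n" for i
    using \<tau>_le_n \<tau>_less[of "t i - 1" i] t[of i] by auto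
  have "convex A"
    unfolding A_def using conc_concave[OF polyhedron_imp_convex[OF polyhedron_Delta]]
      face_of_imp_convex[OF slab_face_of_Delta[OF tn(1)]]
    by (intro convex_Int convex_Times) (auto simp: ereal_concave_on_def)
  moreover have "linear (\<lambda>(z :: real ^ 'k::{finite, linorder} ^ 'd, \<mu>::real). (F n a z, \<mu>))"
    by (auto intro!: linearI simp: linear_add[OF linear_F] linear_scale[OF linear_F])
  ultimately have "convex ((\<lambda>(z, \<mu>). (F n a z, \<mu>)) ` A)" by (rule convex_linear_image[rotated])
  moreover have "hyp (cell t) \<phi> \<subseteq> (\<lambda>(z, \<mu>). (F n a z, \<mu>)) ` A"
  proof
    fix p assume "p \<in> hyp (cell t) \<phi>"
    then obtain f \<mu> where p: "p = (f, \<mu>)" "f \<in> cell t" "\<mu> \<le> \<phi> f" by (auto simp: hyp_def)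
    obtain z :: "real ^ 'k::{finite, linorder} ^ 'd" where z: "z \<in> piece t" "F n a z = f"
      using F_slab_surj[OF p(2) tn(2,3)] by blast
    have zD: "z \<in> Delta n" using z by (simp add: slab_def)
    have "ereal \<mu> \<le> g z" using p z by simp
    also have "g z \<le> conc (Delta n) g z" using conc_overestimates[OF zD] .
    finally show "p \<in> (\<lambda>(z, \<mu>). (F n a z, \<mu>)) ` A"
      using z zD p by (force simp: A_def)
  qed
  ultimately have "convex hull (hyp (cell t) \<phi>) \<subseteq> (\<lambda>(z, \<mu>). (F n a z, \<mu>)) ` A"
    by (rule hull_minimal[rotated])
  also have "\<dots> \<subseteq> fst ` E"
    using piece_imp_E[OF t] by (auto simp: A_def)
  finally show ?thesis .
qed

text \<open>The hull of each cell lies in the projection for arbitrary \<open>\<phi>\<close>, so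
  both cases reduce to the opposite inclusion on a single piece.\<close>

lemma mip_formulation_if:
  assumes "\<And>t (z :: real ^ 'k::{finite, linorder} ^ 'd) \<mu>. (\<And>i. t i \<in> {1..l i}) \<Longrightarrow> z \<in> piece t
    \<Longrightarrow> ereal \<mu> \<le> conc (Delta n) g z \<Longrightarrow> (F n a z, \<mu>) \<in> convex hull (hyp (cell t) \<phi>)"
  shows "mip_formulation (\<Union>H\<in>boxes a \<tau> l. convex hull (hyp H \<phi>)) E R"
  unfolding mip_formulation_def
proof (intro conjI E_eq subset_antisym)
  have "convex hull (hyp H \<phi>) \<subseteq> fst ` E" if H: "H \<in> boxes a \<tau> l" for H
  proof -
    obtain t where "H = cell t" "\<And>i. t i \<in> {1..l i}" using H unfolding boxes_def by blast
    then show ?thesis using convex_hull_hyp_subset_fst_E[of t] by simp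
  qed
  then show "(\<Union>H\<in>boxes a \<tau> l. convex hull (hyp H \<phi>)) \<subseteq> fst ` E" by blast
  show "fst ` E \<subseteq> (\<Union>H\<in>boxes a \<tau> l. convex hull (hyp H \<phi>))"
  proof
    fix q assume "q \<in> fst ` E"
    then obtain f \<mu> z \<delta> where q: "q = (f, \<mu>)" and p: "((f, \<mu>), z, \<delta>) \<in> E" by force
    then obtain t where t: "\<And>i. t i \<in> {1..l i}" "z \<in> piece t" using E_imp_piece by blast
    moreover have "ereal \<mu> \<le> conc (Delta n) g z" "f = F n a z" using p by (auto simp: formulation_def)
    ultimately have "(f, \<mu>) \<in> convex hull (hyp (cell t) \<phi>)" using assms by blast
    moreover have "cell t \<in> boxes a \<tau> l" using t(1) by (auto simp: boxes_def)
    ultimately show "q \<in> (\<Union>H\<in>boxes a \<tau> l. convex hull (hyp H \<phi>))" using q by auto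
  qed
qed

section \<open>Validity of the formulation\<close>

lemma convex_Delta: "convex (Delta n :: (real ^ 'k::{finite, linorder} ^ 'd) set)"
  by (rule polyhedron_imp_convex[OF polyhedron_Delta])

lemma finite_vert_Delta: "finite (vert (Delta n :: (real ^ 'k::{finite, linorder} ^ 'd) set))"
  unfolding vert_def by (rule finite_polyhedron_extreme_points[OF polyhedron_Delta])

lemma vert_Delta_subset: "vert (Delta n :: (real ^ 'k::{finite, linorder} ^ 'd) set) \<subseteq> Delta n"
  by (auto simp: vert_def extreme_point_of_def)

text \<open>
  The set \<open>X\<close> is the whole cell if \<open>\<phi>\<close> is upper semicontinuous, and the vertex images in it if
  \<open>\<phi> \<circ> F\<close> is concave-extendable from the vertices.
\<close>

lemma conc_piece:
  fixes z :: "real ^ 'k::{finite, linorder} ^ 'd"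
  assumes t: "\<And>i. t i \<in> {1..l i}" and z: "z \<in> piece t" "ereal \<mu> \<le> conc (Delta n) h z"
    and X: "compact X" "\<And>c. closed {f \<in> X. c \<le> \<phi> f}" "X \<subseteq> cell t"
    and h: "\<And>y m. y \<in> piece t \<Longrightarrow> ereal m \<le> h y \<Longrightarrow> F n a y \<in> X \<and> m \<le> \<phi> (F n a y)"
  shows "(F n a z, \<mu>) \<in> convex hull (hyp (cell t) \<phi>)"
proof -
  have tn: "\<tau> i (t i - 1) \<le> n" for i using \<tau>_le_n t[of i] by auto
  \<comment> \<open>The envelope is bounded by the hull over \<open>X\<close>, which is closed, and
    only then is the hull enlarged to the whole cell.\<close>
  have "(F n a z, \<mu>) \<in> convex hull (hyp X \<phi>)"
  proof (rule conc_le_imp_in_closed_convex[OF linear_F convex_Delta slab_face_of_Delta[OF tn]])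
    show "closed (convex hull (hyp X \<phi>))" by (rule closed_convex_hull_hyp[OF X(1,2)])
    show "(F n a y, m) \<in> convex hull (hyp X \<phi>)" if "y \<in> piece t" "ereal m \<le> h y" for y m
      using h[OF that] by (intro hull_inc) (simp add: hyp_def)
  qed (use z in \<open>auto intro: convex_hull_hyp_downward\<close>)
  moreover have "hyp X \<phi> \<subseteq> hyp (cell t) \<phi>" using X(3) by (auto simp: hyp_def)
  ultimately show ?thesis using hull_mono by blast
qed

lemma F_piece:
  fixes z :: "real ^ 'k::{finite, linorder} ^ 'd"
  assumes "\<And>i. t i \<in> {1..l i}" and "z \<in> piece t"
  shows "F n a z \<in> cell t"
proof -
  have "\<tau> i (t i - 1) \<le> n" "\<tau> i (t i) \<le> n" for i
    using \<tau>_le_n assms(1)[of i] by auto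
  then show ?thesis by (intro F_slab_bounds assms(2))
qed

text \<open>Here \<open>X\<close> is the cell: a superlevel set on it is the closed superlevel set
  on the full box, intersected with the cell.\<close>

lemma mip_formulation_usc:
  assumes usc: "usc_on (cbox (\<chi> i. a i 0) (\<chi> i. a i n)) \<phi>"
  shows "mip_formulation (\<Union>H\<in>boxes a \<tau> l. convex hull (hyp H \<phi>)) E R"
proof (rule mip_formulation_if)
  fix t and z :: "real ^ 'k::{finite, linorder} ^ 'd" and \<mu>
  assume t: "\<And>i. t i \<in> {1..l i}" and z: "z \<in> piece t" "ereal \<mu> \<le> conc (Delta n) g z"
  have "a i 0 \<le> a i (\<tau> i (t i - 1))" "a i (\<tau> i (t i)) \<le> a i n" for i
    using t[of i] by (auto intro!: a_mono \<tau>_le_n)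
  note bnd = this
  have sub: "cell t \<subseteq> cbox (\<chi> i. a i 0) (\<chi> i. a i n)"
  proof
    fix x assume "x \<in> cell t"
    then have "a i (\<tau> i (t i - 1)) \<le> x $ i" "x $ i \<le> a i (\<tau> i (t i))" for i
      by (auto simp: mem_box_cart)
    then show "x \<in> cbox (\<chi> i. a i 0) (\<chi> i. a i n)"
      using bnd order_trans unfolding mem_box_cart vec_lambda_beta by blast
  qed
  have "closed {f \<in> cell t. c \<le> \<phi> f}" for c
  proof -
    have "closed {f \<in> cbox (\<chi> i. a i 0) (\<chi> i. a i n). c \<le> \<phi> f}"
      using usc unfolding usc_on_def by (meson closed_cbox closedin_closed_trans)
    then have "closed (cell t \<inter> {f \<in> cbox (\<chi> i. a i 0) (\<chi> i. a i n). c \<le> \<phi> f})"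
      by (intro closed_Int closed_cbox)
    also have "cell t \<inter> {f \<in> cbox (\<chi> i. a i 0) (\<chi> i. a i n). c \<le> \<phi> f} = {f \<in> cell t. c \<le> \<phi> f}"
      using sub by blast
    finally show ?thesis .
  qed
  then show "(F n a z, \<mu>) \<in> convex hull (hyp (cell t) \<phi>)"
    by (rule conc_piece[OF t z compact_cbox _ order_refl]) (use F_piece[OF t] in auto)
qed

section \<open>The concave-extendable case\<close>

context
  assumes ext: "concave_extendable (Delta n) (vert (Delta n)) g"
begin

abbreviation V :: "(real ^ 'k::{finite, linorder} ^ 'd) set" where
  "V \<equiv> vert (Delta n)"

abbreviation gV :: "real ^ 'k::{finite, linorder} ^ 'd \<Rightarrow> ereal" where
  "gV z \<equiv> (if z \<in> V then g z else -\<infinity>)"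

lemma conc_g_eq: "z \<in> Delta n \<Longrightarrow> conc (Delta n) g z = conc (Delta n) gV z"
  using ext by (simp add: concave_extendable_def)

text \<open>The function \<open>gV\<close> has real heights below it only at vertices, so
  \<open>X\<close> can be the finite set of images of the vertices in the piece, whose subsets are
  all closed.\<close>

lemma mip_formulation_ext: "mip_formulation (\<Union>H\<in>boxes a \<tau> l. convex hull (hyp H \<phi>)) E R"
proof (rule mip_formulation_if)
  fix t and z :: "real ^ 'k::{finite, linorder} ^ 'd" and \<mu>
  assume t: "\<And>i. t i \<in> {1..l i}" and z: "z \<in> piece t" "ereal \<mu> \<le> conc (Delta n) g z"
  define X where "X = F n a ` (V \<inter> piece t)"
  have "finite X" using finite_vert_Delta by (simp add: X_def)
  have "ereal \<mu> \<le> conc (Delta n) gV z"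
    using z conc_g_eq by (simp add: slab_def)
  then show "(F n a z, \<mu>) \<in> convex hull (hyp (cell t) \<phi>)"
  proof (rule conc_piece[OF t z(1)])
    show "compact X" "\<And>c. closed {f \<in> X. c \<le> \<phi> f}"
      using \<open>finite X\<close> by (auto intro: finite_imp_compact finite_imp_closed)
    show "X \<subseteq> cell t" using F_piece[OF t] by (auto simp: X_def)
    show "F n a y \<in> X \<and> m \<le> \<phi> (F n a y)" if "y \<in> piece t" "ereal m \<le> gV y" for y m
      using that by (auto simp: X_def split: if_splits)
  qed
qed

text \<open>Left to right, the face argument is applied with \<open>Delta\<close> itself as the face
  and the identity as the map, the hull over finitely many vertices being closed. Conversely, the
  hypograph of the envelope is convex and contains the generators.\<close>

lemma hypograph_conc:
  "z \<in> Delta n \<and> ereal \<mu> \<le> conc (Delta n) g z \<longleftrightarrow> (z, \<mu>) \<in> convex hull (hyp V (\<lambda>z. \<phi> (F n a z)))"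
  (is "_ \<longleftrightarrow> _ \<in> ?C")
proof
  assume z: "z \<in> Delta n \<and> ereal \<mu> \<le> conc (Delta n) g z"
  have "(id z, \<mu>) \<in> ?C"
  proof (rule conc_le_imp_in_closed_convex[OF linear_id convex_Delta face_of_refl[OF convex_Delta]])
    show "closed ?C"
      by (rule polyhedron_imp_closed[OF polyhedron_convex_hull_hyp[OF finite_vert_Delta]])
    show "(id y, m) \<in> ?C" if "ereal m \<le> gV y" for y m
      using that by (intro hull_inc) (auto simp: hyp_def split: if_splits)
    show "z \<in> Delta n" "ereal \<mu> \<le> conc (Delta n) gV z"
      using z conc_g_eq by auto
  qed (auto intro: convex_hull_hyp_downward)
  then show "(z, \<mu>) \<in> ?C" by simp
next
  assume C: "(z, \<mu>) \<in> ?C"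
  have "?C \<subseteq> {(z, \<mu>). z \<in> Delta n \<and> ereal \<mu> \<le> conc (Delta n) g z}"
  proof (rule hull_minimal)
    show "convex {(z :: real ^ 'k::{finite, linorder} ^ 'd, \<mu>). z \<in> Delta n \<and> ereal \<mu> \<le> conc (Delta n) g z}"
      using conc_concave[OF convex_Delta] by (simp add: ereal_concave_on_def)
    show "hyp V (\<lambda>z. \<phi> (F n a z)) \<subseteq> {(z, \<mu>). z \<in> Delta n \<and> ereal \<mu> \<le> conc (Delta n) g z}"
    proof clarify
      fix v \<mu> assume "(v, \<mu>) \<in> hyp V (\<lambda>z. \<phi> (F n a z))"
      then have v: "v \<in> Delta n" "ereal \<mu> \<le> g v"
        using vert_Delta_subset by (auto simp: hyp_def)
      then show "v \<in> Delta n \<and> ereal \<mu> \<le> conc (Delta n) g v"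
        using conc_overestimates[OF v(1), of g] order_trans by blast
    qed
  qed
  then show "z \<in> Delta n \<and> ereal \<mu> \<le> conc (Delta n) g z" using C by blast
qed

text \<open>Every condition other than hull membership is put as a linear function compared with a
  constant, ready for the polyhedron rules.\<close>

lemma mem_R_iff: "((f, \<mu>), z, \<delta>) \<in> R \<longleftrightarrow>
    (z, \<mu>) \<in> convex hull (hyp V (\<lambda>z. \<phi> (F n a z))) \<and> f - F n a z = 0 \<and>
    (\<forall>i\<in>UNIV. \<forall>t\<in>{1..<l i}. - \<delta> $ (i, idx t) \<le> 0 \<and> \<delta> $ (i, idx t) \<le> 1 \<and>
       \<delta> $ (i, idx t) - z $ i $ idx (\<tau> i t) \<le> 0 \<and> z $ i $ idx (\<tau> i t + 1) - \<delta> $ (i, idx t) \<le> 0) \<and>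
    (\<forall>i\<in>UNIV. \<forall>k\<in>- idx ` {1..<l i}. \<delta> $ (i, k) = 0)"
  unfolding hypograph_conc[symmetric] by (auto simp: formulation_def)

lemma polyhedron_R: "polyhedron R"
proof -
  let ?f = "\<lambda>p :: ((real ^ 'd) \<times> real) \<times> (real ^ 'k::{finite, linorder} ^ 'd) \<times> (real ^ ('d \<times> 'k::{finite, linorder})). fst (fst p)"
    and ?\<mu> = "\<lambda>p :: ((real ^ 'd) \<times> real) \<times> (real ^ 'k::{finite, linorder} ^ 'd) \<times> (real ^ ('d \<times> 'k::{finite, linorder})). snd (fst p)"
    and ?z = "\<lambda>p :: ((real ^ 'd) \<times> real) \<times> (real ^ 'k::{finite, linorder} ^ 'd) \<times> (real ^ ('d \<times> 'k::{finite, linorder})). fst (snd p)"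
    and ?\<delta> = "\<lambda>p :: ((real ^ 'd) \<times> real) \<times> (real ^ 'k::{finite, linorder} ^ 'd) \<times> (real ^ ('d \<times> 'k::{finite, linorder})). snd (snd p)"
  have lz: "linear (\<lambda>p. ?z p $ i $ k)" and l\<delta>: "linear (\<lambda>p. ?\<delta> p $ ik)" for i k ik
    by (auto intro!: linearI)
  have lf: "linear (\<lambda>p. ?f p - F n a (?z p))"
    by (auto intro!: linearI simp: linear_add[OF linear_F] linear_scale[OF linear_F] algebra_simps)
  have lzm: "linear (\<lambda>p. (?z p, ?\<mu> p))" by (auto intro!: linearI)
  have C: "polyhedron {p. (?z p, ?\<mu> p) \<in> convex hull (hyp V (\<lambda>z. \<phi> (F n a z)))}"
    using polyhedron_affine_preimage[OF lzm polyhedron_convex_hull_hyp[OF finite_vert_Delta], of 0] by simp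
  have "R = {p. (?z p, ?\<mu> p) \<in> convex hull (hyp V (\<lambda>z. \<phi> (F n a z))) \<and> ?f p - F n a (?z p) = 0 \<and>
    (\<forall>i\<in>UNIV. \<forall>t\<in>{1..<l i}. - ?\<delta> p $ (i, idx t) \<le> 0 \<and> ?\<delta> p $ (i, idx t) \<le> 1 \<and>
       ?\<delta> p $ (i, idx t) - ?z p $ i $ idx (\<tau> i t) \<le> 0 \<and> ?z p $ i $ idx (\<tau> i t + 1) - ?\<delta> p $ (i, idx t) \<le> 0) \<and>
    (\<forall>i\<in>UNIV. \<forall>k\<in>- idx ` {1..<l i}. ?\<delta> p $ (i, k) = 0)}"
    using mem_R_iff by force
  also have "polyhedron \<dots>"
    by (intro polyhedron_Collect_conj polyhedron_Collect_ball C polyhedron_linear_eq polyhedron_linear_le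
          linear_compose_neg linear_compose_sub lz l\<delta> lf) simp_all
  finally show ?thesis .
qed

text \<open>
  Fixing the relative position \<open>\<theta>\<close> of each \<open>\<delta>\<^sub>i\<^sub>t\<close> between its two bounds makes \<open>\<delta>\<close> a linear function
  of \<open>z\<close>. So writing \<open>(z, \<mu>)\<close> as a convex combination of points over vertices of \<open>\<Delta>\<close> decomposes
  the whole point of \<open>R\<close>, and an extreme point must lie over a vertex, where the bounds are binary.
\<close>

lemma ideal_R: "ideal R"
  unfolding ideal_def
proof clarsimp
  fix f \<mu> z and \<delta> :: "real ^ ('d \<times> 'k::{finite, linorder})"
  assume ext: "((f, \<mu>), z, \<delta>) \<in> vert R"
  then have pR: "((f, \<mu>), z, \<delta>) \<in> R" by (simp add: vert_def extreme_point_of_def)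
  \<comment> \<open>\<open>rank\<close> recovers the index \<open>t\<close> from a position;
    \<open>A\<close> and \<open>B\<close> then locate the entries of \<open>z\<close> that bound the
    variable from above and below.\<close>
  define rank :: "'k \<Rightarrow> nat" where "rank = inv_into {..n} idx"
  have rank: "rank (idx j) = j" if "j \<le> n" for j
    using bij_betw_idx[OF card] that by (simp add: rank_def bij_betw_def inv_into_f_f)
  define A :: "'d \<Rightarrow> 'k \<Rightarrow> 'k" where "A i k = idx (\<tau> i (rank k))" for i k
  define B :: "'d \<Rightarrow> 'k \<Rightarrow> 'k" where "B i k = idx (\<tau> i (rank k) + 1)" for i k
  \<comment> \<open>If the two bounds coincide, division by zero gives \<open>0\<close>, which is
    harmless: \<delta> then equals the common bound for any weight.\<close>
  define \<theta> where "\<theta> i k = (\<delta> $ (i, k) - z $ i $ B i k) / (z $ i $ A i k - z $ i $ B i k)" for i k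
  define J :: "'d \<Rightarrow> 'k set" where "J i = idx ` {1..<l i}" for i
  have R_iff: "((f', \<mu>'), z', \<delta>') \<in> R \<longleftrightarrow> z' \<in> Delta n \<and> ereal \<mu>' \<le> conc (Delta n) g z' \<and> f' = F n a z' \<and>
      (\<forall>i. \<forall>k\<in>J i. z' $ i $ B i k \<le> \<delta>' $ (i, k) \<and> \<delta>' $ (i, k) \<le> z' $ i $ A i k) \<and>
      (\<forall>i. \<forall>k\<in>-J i. \<delta>' $ (i, k) = 0)"
    for f' \<mu>' z' and \<delta>' :: "real ^ ('d \<times> 'k::{finite, linorder})"
  proof -
    have 1: "A i (idx t) = idx (\<tau> i t)" "B i (idx t) = idx (\<tau> i t + 1)" if "t \<in> {1..<l i}" for i t
      using rank[of t] l_le_n[of i] that by (simp_all add: A_def B_def)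
    \<comment> \<open>Both bounds are entries of a point of \<open>Delta\<close>, so they confine
      the variable to the unit interval.\<close>
    have 2: "0 \<le> \<delta>' $ (i, idx t) \<and> \<delta>' $ (i, idx t) \<le> 1"
      if "z' \<in> Delta n" "t \<in> {1..<l i}" "z' $ i $ idx (\<tau> i t + 1) \<le> \<delta>' $ (i, idx t)"
        "\<delta>' $ (i, idx t) \<le> z' $ i $ idx (\<tau> i t)" for i t
      using Delta_bounds[OF that(1), of "\<tau> i t" i] Delta_bounds[OF that(1), of "\<tau> i t + 1" i]
        \<tau>_less_n[of t i] that by simp
    have "(\<forall>i. \<forall>t\<in>{1..<l i}. \<delta>' $ (i, idx t) \<in> {0..1} \<and>
              z' $ i $ idx (\<tau> i t) \<ge> \<delta>' $ (i, idx t) \<and>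
              \<delta>' $ (i, idx t) \<ge> z' $ i $ idx (\<tau> i t + 1))
        \<longleftrightarrow> (\<forall>i. \<forall>k\<in>J i. z' $ i $ B i k \<le> \<delta>' $ (i, k) \<and> \<delta>' $ (i, k) \<le> z' $ i $ A i k)"
      if z': "z' \<in> Delta n"
      unfolding J_def ball_simps
      using 2[OF z'] by (intro iff_allI ball_cong refl) (auto simp: 1)
    then show ?thesis
      unfolding formulation_def mem_Collect_eq prod.case J_def by fastforce
  qed
  define \<delta>\<^sub>0 :: "real ^ 'k::{finite, linorder} ^ 'd \<Rightarrow> real ^ ('d \<times> 'k::{finite, linorder})" where
    "\<delta>\<^sub>0 x = vec_lambda (\<lambda>(i, k). if k \<in> J i then (1 - \<theta> i k) * x $ i $ B i k + \<theta> i k * x $ i $ A i k else 0)" for x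
  define L where "L = (\<lambda>(x, m::real). ((F n a x, m), x, \<delta>\<^sub>0 x))"
  have "linear L"
    unfolding L_def
    by (rule linearI) (auto simp: linear_add[OF linear_F] linear_scale[OF linear_F] \<delta>\<^sub>0_def vec_eq_iff algebra_simps)
  have \<delta>: "z $ i $ B i k \<le> \<delta> $ (i, k)" "\<delta> $ (i, k) \<le> z $ i $ A i k" if "k \<in> J i" for i k
    using pR that by (auto simp: R_iff)
  have \<theta>: "0 \<le> \<theta> i k" "\<theta> i k \<le> 1" if "k \<in> J i" for i k
    using \<delta>[OF that] by (auto simp: \<theta>_def divide_le_eq_1)
  have "\<delta>\<^sub>0 z $ (i, k) = \<delta> $ (i, k)" for i k
  proof (cases "k \<in> J i")
    case True
    then have "\<delta>\<^sub>0 z $ (i, k) = z $ i $ B i k + \<theta> i k * (z $ i $ A i k - z $ i $ B i k)"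
      by (simp add: \<delta>\<^sub>0_def algebra_simps)
    also have "\<dots> = \<delta> $ (i, k)" using \<delta>[OF True] by (auto simp: \<theta>_def)
    finally show ?thesis .
  next
    case False
    then show ?thesis using pR by (simp add: \<delta>\<^sub>0_def R_iff)
  qed
  then have "L (z, \<mu>) = ((f, \<mu>), z, \<delta>)"
    using pR by (auto simp: L_def R_iff vec_eq_iff)
  moreover have "(z, \<mu>) \<in> convex hull (hyp V (\<lambda>z. \<phi> (F n a z)))"
    using pR hypograph_conc by (auto simp: R_iff)
  ultimately have "((f, \<mu>), z, \<delta>) \<in> convex hull (L ` hyp V (\<lambda>z. \<phi> (F n a z)))"
    unfolding convex_hull_linear_image[OF \<open>linear L\<close>, symmetric] by (metis image_eqI)
  moreover have "L ` hyp V (\<lambda>z. \<phi> (F n a z)) \<subseteq> R"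
  proof (rule image_subsetI)
    fix q assume q: "q \<in> hyp V (\<lambda>z. \<phi> (F n a z))"
    obtain v m where vq: "q = (v, m)" by fastforce
    then have vm: "(v, m) \<in> hyp V (\<lambda>z. \<phi> (F n a z))" using q by simp
    then have vD: "v \<in> Delta n" and "ereal m \<le> conc (Delta n) g v"
      using hypograph_conc[of v m] hull_inc[OF vm, of convex] by auto
    moreover have "v $ i $ B i k \<le> \<delta>\<^sub>0 v $ (i, k) \<and> \<delta>\<^sub>0 v $ (i, k) \<le> v $ i $ A i k" if k: "k \<in> J i" for i k
    proof -
      obtain t where t: "t \<in> {1..<l i}" "k = idx t" using k by (auto simp: J_def)
      then have "rank k = t" using rank l_le_n[of i] by simp
      then have le: "v $ i $ B i k \<le> v $ i $ A i k"
        unfolding A_def B_def using t \<tau>_less_n[of t i] by (intro Delta_antimono[OF vD]) auto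
      have "\<delta>\<^sub>0 v $ (i, k) = v $ i $ B i k + \<theta> i k * (v $ i $ A i k - v $ i $ B i k)"
        using k by (simp add: \<delta>\<^sub>0_def algebra_simps)
      moreover have "0 \<le> \<theta> i k * (v $ i $ A i k - v $ i $ B i k)"
        "\<theta> i k * (v $ i $ A i k - v $ i $ B i k) \<le> 1 * (v $ i $ A i k - v $ i $ B i k)"
        using \<theta>[OF k] le by (auto intro: mult_left_le_one_le)
      ultimately show ?thesis by simp
    qed
    ultimately show "L q \<in> R"
      by (simp add: vq L_def R_iff) (simp add: \<delta>\<^sub>0_def)
  qed
  then have "convex hull (L ` hyp V (\<lambda>z. \<phi> (F n a z))) \<subseteq> R"
    by (rule hull_minimal) (rule polyhedron_imp_convex[OF polyhedron_R])
  \<comment> \<open>An extreme point of \<open>R\<close> stays extreme in any subset containing it,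
    and an extreme point of a hull is one of its generators.\<close>
  ultimately have "((f, \<mu>), z, \<delta>) extreme_point_of convex hull (L ` hyp V (\<lambda>z. \<phi> (F n a z)))"
    using ext unfolding vert_def extreme_point_of_def by blast
  then have "((f, \<mu>), z, \<delta>) \<in> L ` hyp V (\<lambda>z. \<phi> (F n a z))"
    by (rule extreme_point_of_convex_hull)
  then have zV: "z \<in> V" by (auto simp: L_def hyp_def)
  have "\<delta> $ (i, k) \<in> {0, 1}" for i k
  proof (rule ccontr)
    assume frac: "\<delta> $ (i, k) \<notin> {0, 1}"
    then have k: "k \<in> J i" using pR by (auto simp: R_iff)
    then obtain t where t: "t \<in> {1..<l i}" "k = idx t" by (auto simp: J_def)
    then have "rank k = t" using rank l_le_n[of i] by simp
    then have "z $ i $ A i k \<in> {0, 1}" "z $ i $ B i k \<in> {0, 1}"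
      using t \<tau>_less_n[of t i] vert_Delta_binary[OF zV, of "\<tau> i t" i]
        vert_Delta_binary[OF zV, of "\<tau> i t + 1" i] by (simp_all add: A_def B_def)
    then have AB: "z $ i $ A i k = 1" "z $ i $ B i k = 0" using \<delta>[OF k] frac by auto
    then have c: "0 < \<delta> $ (i, k)" "\<delta> $ (i, k) < 1" using \<delta>[OF k] frac by auto
    \<comment> \<open>Over a vertex, a fractional variable has bounds \<open>0\<close> and
      \<open>1\<close>, so it can be moved alone to either value within \<open>R\<close>, which
      contradicts extremality.\<close>
    define w where "w b = ((f, \<mu>), z, (\<chi> ik. if ik = (i, k) then b else \<delta> $ ik))" for b :: real
    have "w b \<in> R" if "b \<in> {0, 1}" for b
      using pR k AB that by (auto simp: w_def R_iff)
    moreover have "((f, \<mu>), z, \<delta>) = (1 - \<delta> $ (i, k)) *\<^sub>R w 0 + \<delta> $ (i, k) *\<^sub>R w 1"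
      by (auto simp: w_def vec_eq_iff algebra_simps)
    moreover have "w 0 \<noteq> w 1" by (auto simp: w_def vec_eq_iff)
    ultimately show False
      using ext c by (auto simp: vert_def extreme_point_of_def in_segment)
  qed
  then show "\<delta> \<in> binary" by (auto simp: binary_def)
qed

end
end

text \<open>The two implications get the closed hull from different sources: upper semicontinuity on
  the full box in the first, finiteness of the vertex set in the second.\<close>

theorem theorem3p1:
  fixes n :: nat
    and a :: "'d::finite \<Rightarrow> nat \<Rightarrow> real"
    and \<tau> :: "'d \<Rightarrow> nat \<Rightarrow> nat"
    and l :: "'d \<Rightarrow> nat"
    and \<phi> :: "real ^ 'd \<Rightarrow> real"
    and \<Delta> :: "(real ^ 'k::{finite, linorder} ^ 'd) set"
    and E R :: "(((real ^ 'd) \<times> real) \<times> (real ^ 'k::{finite, linorder} ^ 'd) \<times> (real ^ ('d \<times> 'k::{finite, linorder}))) set"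
    and S :: "((real ^ 'd) \<times> real) set"
  assumes card: "CARD('k::{finite, linorder}) = n + 1" and n: "n \<ge> 1"
    and a: "\<And>i j. j < n \<Longrightarrow> a i j < a i (j + 1)"
    and \<tau>_0: "\<And>i. \<tau> i 0 = 0"
    and \<tau>_less: "\<And>i t. t < l i \<Longrightarrow> \<tau> i t < \<tau> i (t + 1)"
    and \<tau>_l: "\<And>i. \<tau> i (l i) = n"
  defines "\<Delta> \<equiv> Delta n"
    and "E \<equiv> formulation {0, 1} n a \<tau> l \<phi>"
    and "R \<equiv> formulation {0..1} n a \<tau> l \<phi>"
    and "S \<equiv> (\<Union>H\<in>boxes a \<tau> l. convex hull (hyp H \<phi>))"
  shows "(usc_on (cbox (\<chi> i. a i 0) (\<chi> i. a i n)) \<phi> \<longrightarrow> mip_formulation S E R)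
       \<and> (concave_extendable \<Delta> (vert \<Delta>) (\<lambda>z. ereal (\<phi> (F n a z)))
            \<longrightarrow> milp_formulation S E R \<and> ideal R)"
proof -
  interpret incremental n a \<tau> l \<phi> "TYPE('k)"
    using card n a \<tau>_0 \<tau>_less \<tau>_l by unfold_locales
  show ?thesis
    unfolding \<Delta>_def E_def R_def S_def milp_formulation_def
    using mip_formulation_usc mip_formulation_ext polyhedron_R ideal_R by blast
qed

end
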